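(* A principally polarized abelian variety of dimension $g$ with period matrix $\tau\in\mathcal{H}_g$ is reducible (i.e. $\tau$ is reducible) if and only if there exist some $M\in\Gamma_g$ and some integer $k$ with $1\le k<g$ such that the following holds: for every odd characteristic $[\varepsilon,\delta]$, written as $[\varepsilon_1\,\varepsilon_2,\delta_1\,\delta_2]$ with $[\varepsilon_1,\delta_1]$ a $k$-dimensional characteristic (the first $k$ entries of $\varepsilon$ and of $\delta$) and $[\varepsilon_2,\delta_2]$ a $(g-k)$-dimensional one (the last $g-k$ entries), $$\partial_{z_i}\theta\begin{bmatrix}\varepsilon\\ \delta\end{bmatrix}(M\cdot\tau,z)\Big|_{z=0}=0$$ for all $i\le k$ if $[\varepsilon_1,\delta_1]$ is even, and for all $i>k$ if $[\varepsilon_1,\delta_1]$ is odd.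
   Context: $\mathcal{H}_g$ is the Siegel upper half-space of symmetric complex $g\times g$ matrices with positive definite imaginary part. $\Gamma_g=Sp(2g,\mathbb{Z})$ acts on $\mathcal{H}_g$ by $M\cdot\tau=(A\tau+B)(C\tau+D)^{-1}$ for $M=\begin{pmatrix}A&B\\ C&D\end{pmatrix}$. A period matrix $\tau\in\mathcal{H}_g$ is called reducible if there exists $M\in\Gamma_g$ such that $M\cdot\tau=\begin{pmatrix}\tau_1&0\\0&\tau_2\end{pmatrix}$ with $\tau_i\in\mathcal{H}_{g_i}$, $g_1+g_2=g$, $g_1,g_2\ge1$. Elements of $(\mathbb{Z}/2\mathbb{Z})^g$ are thought of as vectors of zeros and ones. For $\varepsilon,\delta\in(\mathbb{Z}/2\mathbb{Z})^g$, $\tau\in\mathcal{H}_g$, $z\in\mathbb{C}^g$, $$\theta\begin{bmatrix}\varepsilon\\ \delta\end{bmatrix}(\tau,z)=\sum_{m\in\mathbb{Z}^g}\exp \pi i\left[{}^t\!\left(m+\tfrac{\varepsilon}{2}\right)\tau\left(m+\tfrac{\varepsilon}{2}\right)+2\,{}^t\!\left(m+\tfrac{\varepsilon}{2}\right)\left(z+\tfrac{\delta}{2}\right)\right].$$ A characteristic $[\varepsilon,\delta]$ (of any dimension) is even (resp. odd) if $\varepsilon\cdot\delta=0$ (resp. $=1$) in $\mathbb{Z}/2\mathbb{Z}$. *)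

theory Defs
  imports
    "HOL-Analysis.Derivative"
    "HOL-Analysis.Infinite_Sum"
    "Jordan_Normal_Form.Gauss_Jordan_Elimination"
begin

(* The bullet is kept for the scalar product of carrier-based vectors. *)
unbundle no inner_syntax

definition siegel_upper_half_space :: "nat \<Rightarrow> complex mat set" where
  "siegel_upper_half_space g =
    {\<tau> \<in> carrier_mat g g.
       transpose_mat \<tau> = \<tau> \<and>
       (\<forall>v \<in> carrier_vec g. v \<noteq> 0\<^sub>v g \<longrightarrow> v \<bullet> (map_mat Im \<tau> *\<^sub>v v) > 0)}"

definition standard_symplectic_form :: "nat \<Rightarrow> int mat" where
  "standard_symplectic_form g = four_block_mat (0\<^sub>m g g) (1\<^sub>m g) (- 1\<^sub>m g) (0\<^sub>m g g)"

definition siegel_modular_group :: "nat \<Rightarrow> int mat set" where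
  "siegel_modular_group g =
    {M \<in> carrier_mat (2 * g) (2 * g).
       transpose_mat M * standard_symplectic_form g * M = standard_symplectic_form g}"

(* For M in the modular group and \<tau> in the Siegel upper half-space the factor C \<tau> + D is
   invertible, so that mat_inverse returns Some; other arguments are irrelevant. *)
definition siegel_action :: "nat \<Rightarrow> int mat \<Rightarrow> complex mat \<Rightarrow> complex mat" where
  "siegel_action g M \<tau> =
    (case split_block (map_mat complex_of_int M) g g of (A, B, C, D) \<Rightarrow>
      (A * \<tau> + B) * the (mat_inverse (C * \<tau> + D)))"

definition reducible_period_matrix :: "nat \<Rightarrow> complex mat \<Rightarrow> bool" where
  "reducible_period_matrix g \<tau> \<longleftrightarrow>
    (\<exists>M \<in> siegel_modular_group g. \<exists>g1 g2.
       1 \<le> g1 \<and> 1 \<le> g2 \<and> g1 + g2 = g \<and>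
       (\<exists>\<tau>1 \<in> siegel_upper_half_space g1. \<exists>\<tau>2 \<in> siegel_upper_half_space g2.
          siegel_action g M \<tau> = four_block_mat \<tau>1 (0\<^sub>m g1 g2) (0\<^sub>m g2 g1) \<tau>2))"

(* Elements of (Z/2Z)^g, represented by integer vectors of zeros and ones. *)
definition binary_vecs :: "nat \<Rightarrow> int vec set" where
  "binary_vecs g = {\<epsilon> \<in> carrier_vec g. \<forall>i < g. \<epsilon> $ i \<in> {0, 1}}"

definition even_characteristic :: "int vec \<Rightarrow> int vec \<Rightarrow> bool" where
  "even_characteristic \<epsilon> \<delta> \<longleftrightarrow> (\<epsilon> \<bullet> \<delta>) mod 2 = 0"

definition odd_characteristic :: "int vec \<Rightarrow> int vec \<Rightarrow> bool" where
  "odd_characteristic \<epsilon> \<delta> \<longleftrightarrow> (\<epsilon> \<bullet> \<delta>) mod 2 = 1"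

(* The sum is the unconditional one over the integer lattice of dimension dim_vec \<epsilon>; the
   series converges absolutely for \<tau> in the Siegel upper half-space. *)
definition theta_char :: "int vec \<Rightarrow> int vec \<Rightarrow> complex mat \<Rightarrow> complex vec \<Rightarrow> complex" where
  "theta_char \<epsilon> \<delta> \<tau> z =
    (\<Sum>\<^sub>\<infinity>m \<in> carrier_vec (dim_vec \<epsilon>).
       let u = map_vec complex_of_int m + (1/2) \<cdot>\<^sub>v map_vec complex_of_int \<epsilon>
       in exp (of_real pi * \<i> *
            (u \<bullet> (\<tau> *\<^sub>v u) + 2 * (u \<bullet> (z + (1/2) \<cdot>\<^sub>v map_vec complex_of_int \<delta>)))))"

(* Indices are 0-based: i stands for the (i+1)-st coordinate. *)
definition partial_deriv :: "nat \<Rightarrow> (complex vec \<Rightarrow> complex) \<Rightarrow> complex vec \<Rightarrow> complex" where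
  "partial_deriv i f z = deriv (\<lambda>w. f (z + w \<cdot>\<^sub>v unit_vec (dim_vec z) i)) 0"

end

theory Submission
  imports "HOL-Complex_Analysis.Conformal_Mappings" "Jordan_Normal_Form.Determinant" Defs
begin

text \<open>
  In this summary \<open>\<tau>\<close> stands for the transformed period matrix \<open>M \<cdot> \<tau>\<close>, which again lies in the Siegel
  upper half-space.

  If \<open>\<tau>\<close> is block diagonal, then every theta series with characteristic is a product of two
  theta series of smaller dimension, one of which is odd. An odd factor vanishes at the origin,
  and this kills the derivatives in the directions of the other factor. The factorisation can be
  bypassed: changing the sign of the summation variable on the block that carries the odd
  characteristic permutes the lattice and multiplies every term of the series by \<open>-1\<close>
  (\<open>theta_series_vanishes_if_odd_on_block\<close>).

  Conversely, let \<open>a\<close> be a direction supported in the first \<open>k\<close> coordinates and \<open>b\<close> one supported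
  in the others. The hypothesis implies that \<open>\<partial>\<^sub>a\<theta>[\<epsilon>,\<delta>](0) \<cdot> \<partial>\<^sub>b\<theta>[\<epsilon>,\<delta>](0) = 0\<close> for all odd
  characteristics; for even ones this holds since their gradients vanish. Multiplying the two
  series and substituting \<open>U = N + d\<close>, \<open>V = N - d\<close> for the two summation variables (the
  substitution behind Riemann's addition formula) expresses such a product
  through the second order theta constants \<open>T(\<sigma>) = \<Sum> exp (\<pi>\<i>/2 \<cdot> \<^sup>td \<tau> d)\<close>, where \<open>d\<close> runs over the
  integer vectors congruent to \<open>\<sigma>\<close> modulo 2, and their analogues \<open>W(\<sigma>)\<close> with the additional factor
  \<open>(a \<cdot> d)(b \<cdot> d)\<close>. Fourier inversion in \<open>\<delta>\<close> then yields \<open>W(\<sigma>) T(\<sigma>') = T(\<sigma>) W(\<sigma>')\<close> for all classes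
  \<open>\<sigma>, \<sigma>'\<close> (\<open>theta_nulls_proportional\<close>), hence \<open>W = K \<cdot> T\<close> for a constant \<open>K\<close>.

  The same substitution, applied to \<open>\<theta>(y) = \<theta>[0,0](\<tau>,y)\<close> and its derivatives, gives
  \<open>\<theta> \<cdot> \<partial>\<^sub>a\<partial>\<^sub>b\<theta> - \<partial>\<^sub>a\<theta> \<cdot> \<partial>\<^sub>b\<theta> = const \<cdot> K \<cdot> \<theta>\<^sup>2\<close>. In other words, the mixed derivative
  \<open>\<partial>\<^sub>a\<partial>\<^sub>b log \<theta>\<close> is constant, which
  integrates to \<open>\<theta>(y + s a + t b) \<theta>(y) = exp (const \<cdot> K s t) \<theta>(y + s a) \<theta>(y + t b)\<close>
  (\<open>theta_exponential_splitting\<close>). Periodicity of \<open>\<theta>\<close> under integer vectors forces \<open>K = 0\<close>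
  (\<open>theta_null_hessian_zero\<close>), so \<open>\<theta>\<close> is a product of a function of the first \<open>k\<close> coordinates and a
  function of the others. The quasi-periods \<open>\<tau> e\<^sub>i\<close> and \<open>\<tau> e\<^sub>j\<close> with \<open>i < k \<le> j\<close> act on these
  factors separately. Their actions on the second factor commute only if
  \<open>exp (2\<pi>\<i> \<tau>\<^sub>i\<^sub>j) = 1\<close>, so that the off-diagonal block of \<open>\<tau>\<close> is integral
  (\<open>off_diagonal_integral\<close>), and a translation in the modular group removes it.
\<close>

unbundle no inner_syntax
no_notation Finite_Cartesian_Product.vec.vec_nth (infixl "$" 90)
no_notation Infinite_Set_Sum.abs_summable_on (infix "abs'_summable'_on" 50)

section \<open>Entire functions with constant mixed logarithmic derivative\<close>

text \<open>Termwise differentiation of \<open>\<Sum> c\<^sub>m exp (\<alpha>\<^sub>m s)\<close> over an arbitrary index set: on a disc of radius \<open>R\<close>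
  the terms are dominated by \<open>|c\<^sub>m| exp (R |\<alpha>\<^sub>m|)\<close>, so the finite partial sums converge uniformly
  there, and so do their derivatives by Weierstrass' theorem.\<close>

lemma exponential_sum_has_field_derivative:
  fixes c \<alpha> :: "'a \<Rightarrow> complex"
  assumes "\<And>r. (\<lambda>m. norm (c m) * exp (r * norm (\<alpha> m))) summable_on A"
  shows "((\<lambda>s. \<Sum>\<^sub>\<infinity>m\<in>A. c m * exp (\<alpha> m * s)) has_field_derivative
           (\<Sum>\<^sub>\<infinity>m\<in>A. c m * \<alpha> m * exp (\<alpha> m * s))) (at s)"
proof -
  define R where "R = norm s + 1"
  have R: "R > 0" by (simp add: R_def add_nonneg_pos)
  define F where "F = (\<lambda>X w. \<Sum>m\<in>X. c m * exp (\<alpha> m * w))"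
  define F' where "F' = (\<lambda>X w. \<Sum>m\<in>X. c m * \<alpha> m * exp (\<alpha> m * w))"
  have ul: "uniform_limit (cball 0 R) F (\<lambda>w. \<Sum>\<^sub>\<infinity>m\<in>A. c m * exp (\<alpha> m * w)) (finite_subsets_at_top A)"
    unfolding F_def
  proof (rule Weierstrass_m_test_general)
    fix m and w :: complex
    assume "m \<in> A" "w \<in> cball 0 R"
    then have "norm (\<alpha> m * w) \<le> R * norm (\<alpha> m)"
      by (subst norm_mult, subst mult.commute) (simp add: mult_right_mono)
    then have "norm (exp (\<alpha> m * w)) \<le> exp (R * norm (\<alpha> m))"
      using norm_exp[of "\<alpha> m * w"] by (meson exp_le_cancel_iff order_trans)
    then show "norm (c m * exp (\<alpha> m * w)) \<le> norm (c m) * exp (R * norm (\<alpha> m))"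
      by (simp add: norm_mult mult_left_mono)
  qed (use assms in blast)
  have der: "(F X has_field_derivative F' X w) (at w)" for X w
    unfolding F_def F'_def by (auto intro!: derivative_eq_intros sum.cong)
  have ev: "\<forall>\<^sub>F X in finite_subsets_at_top A. continuous_on (cball 0 R) (F X) \<and>
        (\<forall>w\<in>ball 0 R. (F X has_field_derivative F' X w) (at w))"
  proof (intro always_eventually allI conjI ballI der)
    show "continuous_on (cball 0 R) (F X)" for X
      unfolding F_def by (intro continuous_intros)
  qed
  obtain g' where g': "\<And>w. w \<in> ball 0 R \<Longrightarrow>
      ((\<lambda>w. \<Sum>\<^sub>\<infinity>m\<in>A. c m * exp (\<alpha> m * w)) has_field_derivative g' w) (at w) \<and>
      ((\<lambda>X. F' X w) \<longlongrightarrow> g' w) (finite_subsets_at_top A)"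
    using has_complex_derivative_uniform_limit[OF ev ul _ R] by force
  have s: "s \<in> ball 0 R" by (simp add: R_def)
  then have "((\<lambda>m. c m * \<alpha> m * exp (\<alpha> m * s)) has_sum g' s) A"
    using g'[OF s] by (simp add: has_sum_def F'_def)
  then show ?thesis using g'[OF s] by (simp add: infsumI)
qed

lemma entire_eq_if_locally_eq:
  fixes u v u' v' :: "complex \<Rightarrow> complex"
  assumes "\<And>z. (u has_field_derivative u' z) (at z)"
    and "\<And>z. (v has_field_derivative v' z) (at z)"
    and "e > 0" and "\<And>z. norm z < e \<Longrightarrow> u z = v z"
  shows "u z = v z"
proof (rule analytic_continuation_open[of "ball 0 e" UNIV u v])
  show "u holomorphic_on UNIV" "v holomorphic_on UNIV"
    using assms(1,2) by (auto simp: holomorphic_on_def field_differentiable_def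
        intro: has_field_derivative_at_within)
qed (use assms(3,4) in auto)

lemma nonzero_near_0:
  fixes u :: "complex \<Rightarrow> complex"
  assumes "(u has_field_derivative u') (at 0)" and "u 0 \<noteq> 0"
  obtains e where "e > 0" and "\<And>z. norm z < e \<Longrightarrow> u z \<noteq> 0"
proof -
  have "continuous (at 0) u" using assms(1) by (rule DERIV_isCont)
  then show ?thesis
    using continuous_at_avoid[of 0 u 0] assms(2) that by (auto simp: dist_norm)
qed

text \<open>The hypothesis \<open>rel\<close> says that \<open>\<partial>\<^sub>s\<partial>\<^sub>t log f = K\<close> wherever \<open>f\<close> does not vanish. Integrating in \<open>t\<close> and
  then in \<open>s\<close> near the origin gives the formula; after clearing denominators both sides are
  entire in each variable, so that zeros of \<open>f\<close> away from the origin do no harm.\<close>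

lemma constant_mixed_logarithmic_derivative:
  fixes f f\<^sub>1 f\<^sub>2 f\<^sub>1\<^sub>2 :: "complex \<Rightarrow> complex \<Rightarrow> complex"
  assumes d1: "\<And>s t. ((\<lambda>s. f s t) has_field_derivative f\<^sub>1 s t) (at s)"
    and d2: "\<And>s t. ((\<lambda>t. f s t) has_field_derivative f\<^sub>2 s t) (at t)"
    and d12: "\<And>s t. ((\<lambda>t. f\<^sub>1 s t) has_field_derivative f\<^sub>1\<^sub>2 s t) (at t)"
    and rel: "\<And>s t. f s t * f\<^sub>1\<^sub>2 s t - f\<^sub>1 s t * f\<^sub>2 s t = K * (f s t)\<^sup>2"
    and nz: "f 0 0 \<noteq> 0"
  shows "f s t * f 0 0 = exp (K * s * t) * f s 0 * f 0 t"
proof -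
  have step: "f\<^sub>1 s t * f s 0 = f s t * (f\<^sub>1 s 0 + K * t * f s 0)" if s: "f s 0 \<noteq> 0" for s t
  proof -
    obtain e where e: "e > 0" "\<And>z. norm z < e \<Longrightarrow> f s z \<noteq> 0"
      using nonzero_near_0[OF d2 s] by blast
    \<comment> \<open>For fixed \<open>s\<close>, the derivative of \<open>f\<^sub>1 / f - K x\<close> in the second variable is zero by \<open>rel\<close>.\<close>
    have "\<exists>c. \<forall>x\<in>ball 0 e. f\<^sub>1 s x / f s x - K * x = c"
    proof (rule has_field_derivative_zero_constant)
      fix x assume "x \<in> ball (0::complex) e"
      then have nz': "f s x \<noteq> 0" using e by simp
      have "((\<lambda>x. f\<^sub>1 s x / f s x - K * x) has_field_derivative
          ((f\<^sub>1\<^sub>2 s x * f s x - f\<^sub>1 s x * f\<^sub>2 s x) / (f s x * f s x) - K)) (at x)"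
        using nz' by (auto intro!: derivative_eq_intros d12 d2)
      also have "(f\<^sub>1\<^sub>2 s x * f s x - f\<^sub>1 s x * f\<^sub>2 s x) / (f s x * f s x) - K = 0"
        using rel[of s x] nz' by (simp add: field_simps power2_eq_square)
      finally show "((\<lambda>x. f\<^sub>1 s x / f s x - K * x) has_field_derivative 0) (at x within ball 0 e)"
        by (rule has_field_derivative_at_within)
    qed simp
    then obtain c where c: "\<And>x. norm x < e \<Longrightarrow> f\<^sub>1 s x / f s x - K * x = c" by auto
    have c0: "c = f\<^sub>1 s 0 / f s 0" using c[of 0] e by simp
    have loc: "f\<^sub>1 s x * f s 0 = f s x * (f\<^sub>1 s 0 + K * x * f s 0)" if "norm x < e" for x
      using c[OF that] e(2)[OF that] s unfolding c0 by (simp add: field_simps)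
    have u: "((\<lambda>x. f\<^sub>1 s x * f s 0) has_field_derivative f\<^sub>1\<^sub>2 s x * f s 0) (at x)" for x
      by (auto intro!: derivative_eq_intros d12)
    have v: "((\<lambda>x. f s x * (f\<^sub>1 s 0 + K * x * f s 0)) has_field_derivative
        f\<^sub>2 s x * (f\<^sub>1 s 0 + K * x * f s 0) + f s x * (K * f s 0)) (at x)" for x
      by (rule derivative_eq_intros d2 refl | simp add: algebra_simps)+
    show ?thesis by (rule entire_eq_if_locally_eq[OF u v e(1) loc])
  qed
  obtain e where e: "e > 0" "\<And>z. norm z < e \<Longrightarrow> f z 0 \<noteq> 0"
    using nonzero_near_0[of "\<lambda>s. f s 0", OF d1 nz] by blast
  have "\<exists>c. \<forall>x\<in>ball 0 e. f x t * exp (- (K * x * t)) / f x 0 = c"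
  proof (rule has_field_derivative_zero_constant)
    fix x assume "x \<in> ball (0::complex) e"
    then have nz': "f x 0 \<noteq> 0" using e by simp
    have "((\<lambda>x. f x t * exp (- (K * x * t)) / f x 0) has_field_derivative
        exp (- (K * x * t)) * ((f\<^sub>1 x t - K * t * f x t) * f x 0 - f x t * f\<^sub>1 x 0) / (f x 0 * f x 0)) (at x)"
      using nz' by (auto intro!: derivative_eq_intros d1 simp: algebra_simps)
    also have "(f\<^sub>1 x t - K * t * f x t) * f x 0 - f x t * f\<^sub>1 x 0 = 0"
      using step[OF nz', of t] by (simp add: algebra_simps)
    finally show "((\<lambda>x. f x t * exp (- (K * x * t)) / f x 0) has_field_derivative 0) (at x within ball 0 e)"
      by (simp add: has_field_derivative_at_within)
  qed simp
  then obtain c where c: "\<And>x. norm x < e \<Longrightarrow> f x t * exp (- (K * x * t)) / f x 0 = c" by auto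
  have c0: "c = f 0 t / f 0 0" using c[of 0] e by simp
  have loc: "f x t * f 0 0 = exp (K * x * t) * f x 0 * f 0 t" if "norm x < e" for x
    using c[OF that] e(2)[OF that] nz unfolding c0 by (simp add: field_simps exp_minus)
  have u: "((\<lambda>x. f x t * f 0 0) has_field_derivative f\<^sub>1 x t * f 0 0) (at x)" for x
    by (auto intro!: derivative_eq_intros d1)
  have v: "((\<lambda>x. exp (K * x * t) * f x 0 * f 0 t) has_field_derivative
      (exp (K * x * t) * (K * t) * f x 0 + exp (K * x * t) * f\<^sub>1 x 0) * f 0 t) (at x)" for x
    by (auto intro!: derivative_eq_intros d1 simp: algebra_simps)
  show ?thesis by (rule entire_eq_if_locally_eq[OF u v e(1) loc])
qed

section \<open>Rapidly decreasing families on the integer lattice\<close>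

abbreviation lattice :: "nat \<Rightarrow> int vec set" where
  "lattice \<equiv> carrier_vec"

definition norm1 :: "nat \<Rightarrow> int vec \<Rightarrow> real" where
  "norm1 g U = (\<Sum>i<g. \<bar>real_of_int (U $ i)\<bar>)"

lemma norm1_nonneg [simp]: "0 \<le> norm1 g U"
  by (simp add: norm1_def sum_nonneg)

lemma infsum_mult_infsum:
  fixes f h :: "'a \<Rightarrow> complex"
  assumes f: "f abs_summable_on A" and h: "h abs_summable_on B"
  shows abs_summable_on_Times: "(\<lambda>(x, y). f x * h y) abs_summable_on A \<times> B"
    and "infsum f A * infsum h B = (\<Sum>\<^sub>\<infinity>(x, y)\<in>A \<times> B. f x * h y)"
proof -
  show s: "(\<lambda>(x, y). f x * h y) abs_summable_on A \<times> B"
    unfolding Infinite_Sum.abs_summable_on_Sigma_iff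
    using f h by (auto simp: norm_mult infsum_cmult_right' infsum_nonneg
        intro: summable_on_cmult_left summable_on_cmult_right)
  show "infsum f A * infsum h B = (\<Sum>\<^sub>\<infinity>(x, y)\<in>A \<times> B. f x * h y)"
    using infsum_Sigma'_banach[of "\<lambda>x y. f x * h y", OF abs_summable_summable[OF s]]
    by (simp add: infsum_cmult_right' infsum_cmult_left')
qed

lemma exp_minus_abs_summable: "(\<lambda>n::int. exp (- \<bar>real_of_int n\<bar>)) summable_on UNIV"
proof -
  have "summable (\<lambda>n. exp (-1::real) ^ n)" by (rule summable_geometric) simp
  then have "(\<lambda>n. exp (-1::real) ^ n) summable_on UNIV"
    by (intro norm_summable_imp_summable_on) simp
  then have s: "(\<lambda>n. exp (- real n)) summable_on UNIV"
    by (simp flip: exp_of_nat_mult)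
  have "(\<lambda>n::int. exp (- \<bar>real_of_int n\<bar>)) summable_on range int"
    by (subst summable_on_reindex) (use s in \<open>auto simp: o_def\<close>)
  moreover have "(\<lambda>n::int. exp (- \<bar>real_of_int n\<bar>)) summable_on range (\<lambda>n. - int n)"
    by (subst summable_on_reindex) (use s in \<open>auto simp: o_def inj_on_def\<close>)
  moreover have "x \<in> range int \<union> range (\<lambda>n. - int n)" for x
    by (cases x rule: int_cases2) auto
  then have "range int \<union> range (\<lambda>n. - int n) = UNIV" by blast
  ultimately show ?thesis
    using summable_on_union[of _ "range int" "range (\<lambda>n. - int n)"] by simp
qed

text \<open>Induction on the dimension: the summand is a product over the coordinates, and splitting off
  the first one turns the sum into a product of sums.\<close>

lemma exp_minus_norm1_summable: "(\<lambda>U. exp (- norm1 g U)) summable_on lattice g"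
proof (induction g)
  case 0
  have "lattice 0 = {0\<^sub>v 0}" by auto
  then show ?case by simp
next
  case (Suc g)
  let ?h = "\<lambda>(x::int, U). exp (- \<bar>real_of_int x\<bar>) * exp (- norm1 g U)"
  have "?h summable_on UNIV \<times> lattice g"
  proof (rule summable_on_SigmaI)
    fix x :: int
    show "((\<lambda>U. ?h (x, U)) has_sum (exp (- \<bar>real_of_int x\<bar>) * (\<Sum>\<^sub>\<infinity>U\<in>lattice g. exp (- norm1 g U)))) (lattice g)"
      using Suc.IH by (auto intro!: has_sum_cmult_right)
    show "(\<lambda>x. exp (- \<bar>real_of_int x\<bar>) * (\<Sum>\<^sub>\<infinity>U\<in>lattice g. exp (- norm1 g U))) summable_on UNIV"
      by (intro summable_on_cmult_left exp_minus_abs_summable)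
  qed auto
  moreover have "?h summable_on UNIV \<times> lattice g \<longleftrightarrow>
      (\<lambda>U. exp (- norm1 (Suc g) U)) summable_on lattice (Suc g)"
  proof (rule summable_on_reindex_bij_witness[where j = "\<lambda>(x, U). vCons x U"
        and i = "\<lambda>U. (vec_first U 1 $ 0, vec_last U g)"])
    show "\<And>a. a \<in> UNIV \<times> lattice g \<Longrightarrow> (\<lambda>U. (vec_first U 1 $ 0, vec_last U g)) (case a of (x, U) \<Rightarrow> vCons x U) = a"
      by (auto simp: vec_first_def vec_last_def)
    show "\<And>a. a \<in> UNIV \<times> lattice g \<Longrightarrow> (case a of (x, U) \<Rightarrow> vCons x U) \<in> lattice (Suc g)"
      by auto
    show "\<And>b. b \<in> lattice (Suc g) \<Longrightarrow> (case (vec_first b 1 $ 0, vec_last b g) of (x, U) \<Rightarrow> vCons x U) = b"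
      by (auto simp: vec_first_def vec_last_def vec_eq_iff vec_index_vCons)
    show "\<And>b. b \<in> lattice (Suc g) \<Longrightarrow> (vec_first b 1 $ 0, vec_last b g) \<in> UNIV \<times> lattice g"
      by (auto simp: vec_last_def)
    show "\<And>a. a \<in> UNIV \<times> lattice g \<Longrightarrow> exp (- norm1 (Suc g) (case a of (x, U) \<Rightarrow> vCons x U)) = ?h a"
      by (auto simp: norm1_def sum.lessThan_Suc_shift simp del: sum.lessThan_Suc simp flip: exp_add)
  qed
  ultimately show ?case by simp
qed

text \<open>Closed under multiplication by polynomials and by exponentials of linear forms, and strong
  enough for differentiation under the sum; this covers all series below.\<close>

definition rapidly_decreasing :: "nat \<Rightarrow> int vec set \<Rightarrow> (int vec \<Rightarrow> complex) \<Rightarrow> bool" where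
  "rapidly_decreasing g A c \<longleftrightarrow> (\<forall>r. (\<lambda>U. norm (c U) * exp (r * norm1 g U)) summable_on A)"

lemma rapidly_decreasing_mult:
  assumes "rapidly_decreasing g A c"
    and p: "\<And>U. U \<in> A \<Longrightarrow> norm (p U) \<le> C * exp (r * norm1 g U)"
  shows "rapidly_decreasing g A (\<lambda>U. p U * c U)"
  unfolding rapidly_decreasing_def
proof
  fix r'
  have s: "(\<lambda>U. C * (norm (c U) * exp ((r + r') * norm1 g U))) summable_on A"
    using assms(1) unfolding rapidly_decreasing_def by (intro summable_on_cmult_right) blast
  show "(\<lambda>U. norm (p U * c U) * exp (r' * norm1 g U)) summable_on A"
  proof (rule summable_on_comparison_test[OF s])
    fix U assume "U \<in> A"
    then have "norm (p U) * (norm (c U) * exp (r' * norm1 g U)) \<le>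
        (C * exp (r * norm1 g U)) * (norm (c U) * exp (r' * norm1 g U))"
      by (intro mult_right_mono p) auto
    then show "norm (p U * c U) * exp (r' * norm1 g U) \<le> C * (norm (c U) * exp ((r + r') * norm1 g U))"
      by (simp add: norm_mult algebra_simps exp_add)
  qed auto
qed

lemma rapidly_decreasing_subset:
  "rapidly_decreasing g A c \<Longrightarrow> B \<subseteq> A \<Longrightarrow> rapidly_decreasing g B c"
  unfolding rapidly_decreasing_def by (blast intro: summable_on_subset_banach)

lemma rapidly_decreasing_abs_summable: "rapidly_decreasing g A c \<Longrightarrow> c abs_summable_on A"
  unfolding rapidly_decreasing_def by (drule spec[of _ 0]) simp

lemma rapidly_decreasing_summable: "rapidly_decreasing g A c \<Longrightarrow> c summable_on A"
  using rapidly_decreasing_abs_summable abs_summable_summable by blast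

text \<open>Completing the square in each coordinate bounds a Gaussian by a multiple of \<open>exp (- |x|)\<close>, even
  after multiplication by \<open>exp (r |x|)\<close>.\<close>

lemma rapidly_decreasing_gaussian:
  assumes "\<kappa> > 0" and "\<And>U. U \<in> lattice g \<Longrightarrow> norm (c U) \<le> exp (- \<kappa> * (\<Sum>i<g. (real_of_int (U $ i))\<^sup>2))"
  shows "rapidly_decreasing g (lattice g) c"
  unfolding rapidly_decreasing_def
proof
  fix r
  define C where "C = (r + 1)\<^sup>2 / (4 * \<kappa>)"
  have C: "- \<kappa> * x\<^sup>2 + r * \<bar>x\<bar> \<le> C - \<bar>x\<bar>" for x
  proof -
    have "0 \<le> (2 * \<kappa> * \<bar>x\<bar> - (r + 1))\<^sup>2 / (4 * \<kappa>)" using assms(1) by simp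
    also have "\<dots> = \<kappa> * x\<^sup>2 - (r + 1) * \<bar>x\<bar> + C"
      using assms(1) by (simp add: C_def power2_eq_square field_simps)
    finally show ?thesis by (simp add: algebra_simps)
  qed
  have s: "(\<lambda>U. exp (real g * C) * exp (- norm1 g U)) summable_on lattice g"
    by (intro summable_on_cmult_right exp_minus_norm1_summable)
  show "(\<lambda>U. norm (c U) * exp (r * norm1 g U)) summable_on lattice g"
  proof (rule summable_on_comparison_test[OF s])
    fix U assume U: "U \<in> lattice g"
    have "norm (c U) * exp (r * norm1 g U) \<le>
        exp (- \<kappa> * (\<Sum>i<g. (real_of_int (U $ i))\<^sup>2)) * exp (r * norm1 g U)"
      by (intro mult_right_mono assms(2) U) auto
    also have "\<dots> = exp (\<Sum>i<g. - \<kappa> * (real_of_int (U $ i))\<^sup>2 + r * \<bar>real_of_int (U $ i)\<bar>)"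
      unfolding norm1_def sum_distrib_left sum.distrib exp_add ..
    also have "\<dots> \<le> exp (\<Sum>i<g. C - \<bar>real_of_int (U $ i)\<bar>)"
      using C by (auto intro!: sum_mono)
    also have "\<dots> = exp (real g * C) * exp (- norm1 g U)"
      by (simp add: norm1_def sum_subtractf flip: exp_add)
    finally show "norm (c U) * exp (r * norm1 g U) \<le> exp (real g * C) * exp (- norm1 g U)" .
  qed auto
qed

definition linear_form :: "nat \<Rightarrow> (nat \<Rightarrow> complex) \<Rightarrow> int vec \<Rightarrow> complex" where
  "linear_form g a U = (\<Sum>i<g. a i * of_int (U $ i))"

lemma linear_form_add:
  "U \<in> lattice g \<Longrightarrow> V \<in> lattice g \<Longrightarrow> linear_form g a (U + V) = linear_form g a U + linear_form g a V"
  by (simp add: linear_form_def sum.distrib algebra_simps)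

lemma linear_form_diff:
  "U \<in> lattice g \<Longrightarrow> V \<in> lattice g \<Longrightarrow> linear_form g a (U - V) = linear_form g a U - linear_form g a V"
  by (simp add: linear_form_def sum_subtractf algebra_simps)

lemma norm_linear_form_le: "norm (linear_form g a U) \<le> (\<Sum>i<g. norm (a i)) * norm1 g U"
proof -
  have "norm (linear_form g a U) \<le> (\<Sum>i<g. norm (a i) * \<bar>real_of_int (U $ i)\<bar>)"
    unfolding linear_form_def by (rule sum_norm_le) (simp add: norm_mult)
  also have "\<dots> \<le> (\<Sum>i<g. norm (a i) * norm1 g U)"
    unfolding norm1_def by (intro sum_mono mult_left_mono member_le_sum) auto
  finally show ?thesis by (simp add: sum_distrib_right)
qed

lemma norm_linear_form_le_exp: "norm (linear_form g a U) \<le> (\<Sum>i<g. norm (a i)) * exp (1 * norm1 g U)"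
proof -
  have "norm1 g U \<le> exp (1 * norm1 g U)" by (rule order_trans[OF _ exp_ge_add_one_self]) simp
  then have "(\<Sum>i<g. norm (a i)) * norm1 g U \<le> (\<Sum>i<g. norm (a i)) * exp (1 * norm1 g U)"
    by (intro mult_left_mono) (auto intro: sum_nonneg)
  then show ?thesis using norm_linear_form_le[of g a U] by linarith
qed

lemma norm_exp_linear_form_le:
  "norm (exp (c * linear_form g a U)) \<le> 1 * exp ((norm c * (\<Sum>i<g. norm (a i))) * norm1 g U)"
proof -
  have "norm (exp (c * linear_form g a U)) \<le> exp (norm c * norm (linear_form g a U))"
    using norm_exp[of "c * linear_form g a U"] by (simp add: norm_mult)
  also have "\<dots> \<le> exp (norm c * ((\<Sum>i<g. norm (a i)) * norm1 g U))"
    by (simp add: mult_left_mono norm_linear_form_le)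
  finally show ?thesis by (simp add: mult.assoc)
qed

lemma rapidly_decreasing_exp_linear_form:
  "rapidly_decreasing g A c \<Longrightarrow> rapidly_decreasing g A (\<lambda>U. exp (k * linear_form g a U) * c U)"
  by (rule rapidly_decreasing_mult[OF _ norm_exp_linear_form_le])


text \<open>The class of \<open>\<sigma>\<close> modulo 2. Theta series are summed over \<open>U = 2m + \<epsilon>\<close> instead of the half-integral
  vectors \<open>m + \<epsilon>/2\<close>, so that all summation variables stay integral.\<close>

definition coset :: "nat \<Rightarrow> int vec \<Rightarrow> int vec set" where
  "coset g \<sigma> = {U \<in> lattice g. \<forall>i<g. even (U $ i - \<sigma> $ i)}"

lemma coset_subset: "coset g \<sigma> \<subseteq> lattice g"
  by (auto simp: coset_def)

lemma coset_eq: "N \<in> coset g \<sigma> \<Longrightarrow> coset g (N + \<epsilon>) = coset g (\<sigma> + \<epsilon>)" if "\<epsilon> \<in> lattice g" "\<sigma> \<in> lattice g"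
  using that unfolding coset_def by (intro Collect_cong conj_cong refl all_cong) auto

lemma coset_cong:
  assumes "\<And>i. i < g \<Longrightarrow> even (\<sigma> $ i - \<sigma>' $ i)"
  shows "coset g \<sigma> = coset g \<sigma>'"
proof -
  have "even (U $ i - \<sigma> $ i) \<longleftrightarrow> even (U $ i - \<sigma>' $ i)" if "i < g" for U i
    using assms[OF that] by presburger
  then show ?thesis unfolding coset_def by blast
qed

lemma coset_diff_even: "U \<in> coset g \<sigma> \<Longrightarrow> V \<in> coset g \<sigma> \<Longrightarrow> i < g \<Longrightarrow> even (U $ i - V $ i)"
  unfolding coset_def by auto

lemma has_sum_diff:
  fixes f h :: "'a \<Rightarrow> complex"
  assumes f: "(f has_sum x) A" and h: "(h has_sum y) A"
  shows "((\<lambda>u. f u - h u) has_sum (x - y)) A"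
  using has_sum_add[OF f has_sum_uminusI[OF h]] by simp

definition moderate_growth :: "nat \<Rightarrow> (int vec \<Rightarrow> complex) \<Rightarrow> bool" where
  "moderate_growth g p \<longleftrightarrow> (\<exists>C r. \<forall>U\<in>lattice g. norm (p U) \<le> C * exp (r * norm1 g U))"

lemma moderate_growth_const: "moderate_growth g (\<lambda>U. c)"
  unfolding moderate_growth_def by (rule exI[of _ "norm c"], rule exI[of _ 0]) simp

lemma moderate_growth_linear_form: "moderate_growth g (linear_form g a)"
  unfolding moderate_growth_def using norm_linear_form_le_exp by blast

lemma moderate_growth_mult:
  assumes "moderate_growth g p" "moderate_growth g q"
  shows "moderate_growth g (\<lambda>U. p U * q U)"
proof -
  obtain C r D s where p: "\<And>U. U \<in> lattice g \<Longrightarrow> norm (p U) \<le> C * exp (r * norm1 g U)"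
    and q: "\<And>U. U \<in> lattice g \<Longrightarrow> norm (q U) \<le> D * exp (s * norm1 g U)"
    using assms unfolding moderate_growth_def by blast
  have "norm (p U * q U) \<le> (C * D) * exp ((r + s) * norm1 g U)" if U: "U \<in> lattice g" for U
  proof -
    have "norm (p U * q U) \<le> (C * exp (r * norm1 g U)) * (D * exp (s * norm1 g U))"
      unfolding norm_mult using p[OF U] q[OF U] by (intro mult_mono) (auto intro: order_trans[OF norm_ge_zero])
    then show ?thesis by (simp add: algebra_simps exp_add)
  qed
  then show ?thesis unfolding moderate_growth_def by blast
qed

lemma rapidly_decreasing_moderate:
  assumes "rapidly_decreasing g A c" "moderate_growth g p" "A \<subseteq> lattice g"
  shows "rapidly_decreasing g A (\<lambda>U. p U * c U)"
proof -
  obtain C r where "\<And>U. U \<in> lattice g \<Longrightarrow> norm (p U) \<le> C * exp (r * norm1 g U)"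
    using assms(2) unfolding moderate_growth_def by blast
  then show ?thesis
    using assms(3) by (intro rapidly_decreasing_mult[OF assms(1), of p C r]) blast
qed

lemma linear_form_uminus: "U \<in> lattice g \<Longrightarrow> linear_form g a (- U) = - linear_form g a U"
  by (simp add: linear_form_def sum_negf)

lemma linear_form_add_coeff: "linear_form g (\<lambda>i. a i + b i) U = linear_form g a U + linear_form g b U"
  by (simp add: linear_form_def sum.distrib algebra_simps)

lemma linear_form_scale: "linear_form g (\<lambda>i. c * a i) U = c * linear_form g a U"
  by (simp add: linear_form_def sum_distrib_left algebra_simps)

section \<open>Characters of finite quotients of the lattice\<close>

lemma exp_two_pi_i_eq_1_iff:
  "exp (2 * of_real pi * \<i> * z) = 1 \<longleftrightarrow> z \<in> \<int>"
proof -
  have "exp (2 * of_real pi * \<i> * z) = 1 \<longleftrightarrow> Im z = 0 \<and> (\<exists>n::int. 2 * pi * Re z = of_int (2 * n) * pi)"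
    by (simp add: exp_eq_1)
  also have "\<dots> \<longleftrightarrow> Im z = 0 \<and> (\<exists>n::int. Re z = of_int n)" by auto
  also have "\<dots> \<longleftrightarrow> z \<in> \<int>"
    by (simp add: complex_is_Int_iff)
  finally show ?thesis .
qed

lemma sum_roots_of_unity:
  assumes "n > 0"
  shows "(\<Sum>x\<in>{0..<int n}. exp (2 * of_real pi * \<i> * (of_int u * of_int x / of_nat n))) =
    (if int n dvd u then of_nat n else 0)"
proof -
  define w where "w = exp (2 * of_real pi * \<i> * (of_int u / of_nat n))"
  have w1: "w = 1 \<longleftrightarrow> int n dvd u"
  proof -
    have "(of_int u / of_nat n :: complex) \<in> \<int> \<longleftrightarrow> int n dvd u"
      using of_int_div_of_int_in_Ints_iff[of u "int n", where 'a = complex] assms by auto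
    then show ?thesis unfolding w_def exp_two_pi_i_eq_1_iff .
  qed
  have wn: "w ^ n = 1"
  proof -
    have "w ^ n = exp (2 * of_real pi * \<i> * of_int u)"
      using assms by (simp add: w_def flip: exp_of_nat_mult)
    then show ?thesis using exp_two_pi_i_eq_1_iff[of "of_int u"] by simp
  qed
  have "{0..<int n} = int ` {..<n}" by (simp add: lessThan_atLeast0 image_int_atLeastLessThan)
  then have "(\<Sum>x\<in>{0..<int n}. exp (2 * of_real pi * \<i> * (of_int u * of_int x / of_nat n))) = (\<Sum>k<n. w ^ k)"
    by (simp add: sum.reindex w_def flip: exp_of_nat_mult) (simp add: algebra_simps)
  also have "\<dots> = (if int n dvd u then of_nat n else 0)"
    using w1 wn by (auto simp: sum_gp_strict)
  finally show ?thesis .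
qed

definition cube :: "nat \<Rightarrow> nat \<Rightarrow> int vec set" where
  "cube g n = {\<delta> \<in> lattice g. \<forall>i<g. \<delta> $ i \<in> {0..<int n}}"

lemma cube_bij: "bij_betw (vec g) (PiE {..<g} (\<lambda>_. {0..<int n})) (cube g n)"
proof (rule bij_betwI)
  let ?P = "PiE {..<g} (\<lambda>_. {0..<int n})" and ?r = "\<lambda>\<delta>. \<lambda>i\<in>{..<g}. \<delta> $ i"
  show "vec g \<in> ?P \<rightarrow> cube g n"
    unfolding cube_def by (fastforce dest: PiE_mem)
  show "?r \<in> cube g n \<rightarrow> ?P"
    unfolding cube_def by (intro Pi_I restrict_PiE_iff[THEN iffD2] ballI) simp
  show "?r (vec g x) = x" if "x \<in> ?P" for x
    using that by (intro PiE_ext[of _ "{..<g}" "\<lambda>_. UNIV"]) (auto simp: PiE_def)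
  show "vec g (?r \<delta>) = \<delta>" if "\<delta> \<in> cube g n" for \<delta>
    using that by (auto simp: cube_def)
qed

text \<open>Orthogonality of characters of \<open>(\<int>/n)\<^sup>g\<close>. It is used with \<open>n = 2\<close> to invert a Fourier transform in
  \<open>\<delta>\<close>, and with large \<open>n\<close> to isolate the constant term of a Fourier series.\<close>

lemma sum_cube_characters:
  assumes "n > 0"
  shows "(\<Sum>\<delta>\<in>cube g n. exp (2 * of_real pi * \<i> * (\<Sum>i<g. of_int (U $ i) * of_int (\<delta> $ i) / of_nat n))) =
    (if \<forall>i<g. int n dvd U $ i then of_nat n ^ g else 0)"
proof -
  define e where "e = (\<lambda>i x. exp (2 * of_real pi * \<i> * (of_int (U $ i) * of_int x / of_nat n)))"
  have "(\<Sum>\<delta>\<in>cube g n. exp (2 * of_real pi * \<i> * (\<Sum>i<g. of_int (U $ i) * of_int (\<delta> $ i) / of_nat n))) =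
      (\<Sum>\<delta>\<in>cube g n. \<Prod>i<g. e i (\<delta> $ i))"
    by (simp add: e_def exp_sum sum_distrib_left)
  also have "\<dots> = (\<Sum>\<delta>\<in>PiE {..<g} (\<lambda>_. {0..<int n}). \<Prod>i<g. e i (\<delta> i))"
    by (subst sum.reindex_bij_betw[OF cube_bij, symmetric]) (auto intro!: sum.cong prod.cong)
  also have "\<dots> = (\<Prod>i<g. \<Sum>x\<in>{0..<int n}. e i x)"
    by (rule prod_sum_PiE[symmetric]) auto
  also have "\<dots> = (\<Prod>i<g. if int n dvd U $ i then of_nat n else 0)"
    unfolding e_def by (intro prod.cong refl sum_roots_of_unity assms)
  also have "\<dots> = (if \<forall>i<g. int n dvd U $ i then of_nat n ^ g else 0)"
    by (auto simp: prod_zero_iff)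
  finally show ?thesis .
qed

lemma cube_2_eq_binary_vecs: "cube g 2 = binary_vecs g"
  by (auto simp: cube_def binary_vecs_def)

section \<open>Positive definite matrices\<close>

lemma mat_inverse_exists:
  fixes A :: "'a :: field mat"
  assumes A: "A \<in> carrier_mat n n"
    and inj: "\<And>v. v \<in> carrier_vec n \<Longrightarrow> A *\<^sub>v v = 0\<^sub>v n \<Longrightarrow> v = 0\<^sub>v n"
  obtains B where "mat_inverse A = Some B" "B \<in> carrier_mat n n" "A * B = 1\<^sub>m n" "B * A = 1\<^sub>m n"
proof -
  have "Determinant.det A \<noteq> 0"
    using inj unfolding det_0_iff_vec_prod_zero_field[OF A] by blast
  then have "A \<in> Units (ring_mat TYPE('a) n ())" using A by (rule det_non_zero_imp_unit[rotated])
  then obtain B where B: "mat_inverse A = Some B"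
    using mat_inverse(1)[OF A, where b = "()"] by (cases "mat_inverse A") auto
  show thesis using that[OF B] mat_inverse(2)[OF A B] by blast
qed

locale positive_definite =
  fixes n :: nat and Y :: "real mat"
  assumes Y: "Y \<in> carrier_mat n n"
    and sym: "transpose_mat Y = Y"
    and pos: "\<And>v. v \<in> carrier_vec n \<Longrightarrow> v \<noteq> 0\<^sub>v n \<Longrightarrow> v \<bullet> (Y *\<^sub>v v) > 0"
begin

lemma nonneg: "v \<in> carrier_vec n \<Longrightarrow> v \<bullet> (Y *\<^sub>v v) \<ge> 0"
  using pos[of v] Y by (cases "v = 0\<^sub>v n") auto

lemma form_commute:
  assumes "u \<in> carrier_vec n" "v \<in> carrier_vec n"
  shows "u \<bullet> (Y *\<^sub>v v) = v \<bullet> (Y *\<^sub>v u)"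
proof -
  have "u \<bullet> (Y *\<^sub>v v) = (transpose_mat Y *\<^sub>v u) \<bullet> v"
    using transpose_vec_mult_scalar[OF Y assms(2,1)] by simp
  also have "\<dots> = v \<bullet> (Y *\<^sub>v u)"
    using Y assms by (simp add: sym comm_scalar_prod[of _ n])
  finally show ?thesis .
qed

lemma inverse_exists:
  obtains B where "mat_inverse Y = Some B" "B \<in> carrier_mat n n" "Y * B = 1\<^sub>m n" "B * Y = 1\<^sub>m n"
proof (rule mat_inverse_exists[OF Y])
  fix v assume v: "v \<in> carrier_vec n" "Y *\<^sub>v v = 0\<^sub>v n"
  then have "v \<bullet> (Y *\<^sub>v v) = 0" by simp
  then show "v = 0\<^sub>v n" using pos[OF v(1)] by force
qed (use that in blast)

lemma cauchy_schwarz: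
  assumes u: "u \<in> carrier_vec n" and w: "w \<in> carrier_vec n"
  shows "(u \<bullet> (Y *\<^sub>v w))\<^sup>2 \<le> (u \<bullet> (Y *\<^sub>v u)) * (w \<bullet> (Y *\<^sub>v w))"
proof (cases "w = 0\<^sub>v n")
  case True
  then show ?thesis using form_commute[OF u w] Y u by simp
next
  case False
  define p q r where "p = u \<bullet> (Y *\<^sub>v u)" and "q = u \<bullet> (Y *\<^sub>v w)" and "r = w \<bullet> (Y *\<^sub>v w)"
  have r: "r > 0" using pos[OF w False] by (simp add: r_def)
  have carrier: "Y *\<^sub>v u \<in> carrier_vec n" "Y *\<^sub>v w \<in> carrier_vec n" using Y u w by auto
  \<comment> \<open>This \<open>t\<close> minimises the quadratic polynomial \<open>t \<mapsto> p + 2 t q + t\<^sup>2 r\<close>.\<close>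
  define t where "t = - (q / r)"
  have "0 \<le> (u + t \<cdot>\<^sub>v w) \<bullet> (Y *\<^sub>v (u + t \<cdot>\<^sub>v w))"
    using u w by (intro nonneg) auto
  also have "Y *\<^sub>v (u + t \<cdot>\<^sub>v w) = Y *\<^sub>v u + t \<cdot>\<^sub>v (Y *\<^sub>v w)"
    using Y u w by (simp add: mult_add_distrib_mat_vec[OF Y] mult_mat_vec[OF Y])
  also have "(u + t \<cdot>\<^sub>v w) \<bullet> \<dots> = p + t * q + t * (w \<bullet> (Y *\<^sub>v u)) + t * t * r"
    using u w carrier
    by (simp add: add_scalar_prod_distrib[of _ n] scalar_prod_add_distrib[of _ n] p_def q_def r_def algebra_simps)
  also have "w \<bullet> (Y *\<^sub>v u) = q" using form_commute[OF u w] by (simp add: q_def)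
  also have "p + t * q + t * q + t * t * r = p - q\<^sup>2 / r"
    using r by (simp add: t_def power2_eq_square field_simps)
  finally show ?thesis
    using r by (simp add: field_simps flip: p_def q_def r_def)
qed

text \<open>With \<open>Y w\<^sub>i = e\<^sub>i\<close>, the coordinate \<open>v\<^sub>i\<close> is the \<open>Y\<close>-inner product of \<open>v\<close> and \<open>w\<^sub>i\<close>, so the
  Cauchy-Schwarz inequality bounds \<open>v\<^sub>i\<^sup>2\<close> by a multiple of the form at \<open>v\<close>.\<close>

lemma lower_bound:
  obtains \<kappa> where "\<kappa> > 0" and "\<And>v. v \<in> carrier_vec n \<Longrightarrow> \<kappa> * (\<Sum>i<n. (v $ i)\<^sup>2) \<le> v \<bullet> (Y *\<^sub>v v)"
proof -
  obtain B where B: "B \<in> carrier_mat n n" "Y * B = 1\<^sub>m n" using inverse_exists by blast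
  define w where "w = (\<lambda>i. B *\<^sub>v unit_vec n i)"
  have w: "w i \<in> carrier_vec n" for i using B by (simp add: w_def)
  have Yw: "Y *\<^sub>v w i = unit_vec n i" for i
  proof -
    have "Y *\<^sub>v w i = (Y * B) *\<^sub>v unit_vec n i"
      unfolding w_def using Y B(1) by (intro assoc_mult_mat_vec[symmetric]) auto
    then show ?thesis using B by simp
  qed
  define R where "R = (\<Sum>i<n. w i \<bullet> (Y *\<^sub>v w i))"
  have R: "R \<ge> 0" unfolding R_def by (intro sum_nonneg nonneg w)
  show thesis
  proof (rule that[of "1 / (1 + R)"])
    show "1 / (1 + R) > 0" using R by simp
    fix v :: "real vec" assume v: "v \<in> carrier_vec n"
    have "(v $ i)\<^sup>2 \<le> (v \<bullet> (Y *\<^sub>v v)) * (w i \<bullet> (Y *\<^sub>v w i))" if "i < n" for i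
      using cauchy_schwarz[OF v w[of i]] v that by (simp add: Yw)
    then have "(\<Sum>i<n. (v $ i)\<^sup>2) \<le> (\<Sum>i<n. (v \<bullet> (Y *\<^sub>v v)) * (w i \<bullet> (Y *\<^sub>v w i)))"
      by (intro sum_mono) auto
    also have "\<dots> = (v \<bullet> (Y *\<^sub>v v)) * R" by (simp add: R_def sum_distrib_left)
    also have "\<dots> \<le> (v \<bullet> (Y *\<^sub>v v)) * (1 + R)"
      using nonneg[OF v] R by (intro mult_left_mono) auto
    finally show "1 / (1 + R) * (\<Sum>i<n. (v $ i)\<^sup>2) \<le> v \<bullet> (Y *\<^sub>v v)"
      using R by (simp add: field_simps)
  qed
qed

end

lemma siegel_carrier: "\<tau> \<in> siegel_upper_half_space g \<Longrightarrow> \<tau> \<in> carrier_mat g g"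
  and siegel_sym: "\<tau> \<in> siegel_upper_half_space g \<Longrightarrow> transpose_mat \<tau> = \<tau>"
  by (auto simp: siegel_upper_half_space_def)

lemma siegel_imp_positive_definite:
  assumes "\<tau> \<in> siegel_upper_half_space g"
  shows "positive_definite g (map_mat Im \<tau>)"
proof
  show "transpose_mat (map_mat Im \<tau>) = map_mat Im \<tau>"
    using siegel_sym[OF assms] by (metis map_mat_transpose)
qed (use assms in \<open>auto simp: siegel_upper_half_space_def\<close>)

section \<open>The symplectic action on the Siegel upper half-space\<close>

lemma hermitian_form_pos:
  assumes "positive_definite n Y" and v: "v \<in> carrier_vec n" "v \<noteq> 0\<^sub>v n"
  shows "Re (map_vec cnj v \<bullet> (map_mat complex_of_real Y *\<^sub>v v)) > 0"
proof -
  interpret positive_definite n Y by fact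
  define x y where "x = map_vec Re v" and "y = map_vec Im v"
  have xy: "x \<in> carrier_vec n" "y \<in> carrier_vec n" using v by (auto simp: x_def y_def)
  have dim: "dim_row Y = n" "dim_col Y = n" "dim_vec v = n" using Y v by auto
  have "Re (map_vec cnj v \<bullet> (map_mat complex_of_real Y *\<^sub>v v)) = x \<bullet> (Y *\<^sub>v x) + y \<bullet> (Y *\<^sub>v y)"
    using dim by (simp add: x_def y_def scalar_prod_def sum_distrib_left sum.distrib[symmetric] algebra_simps)
  moreover have "x \<noteq> 0\<^sub>v n \<or> y \<noteq> 0\<^sub>v n"
    using v by (auto simp: x_def y_def vec_eq_iff complex_eq_iff)
  ultimately show ?thesis
    using pos[OF xy(1)] pos[OF xy(2)] nonneg[OF xy(1)] nonneg[OF xy(2)] by fastforce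
qed

lemma four_block_upper_left_inject:
  assumes "four_block_mat A B C D = four_block_mat A' B' C' D'" "A \<in> carrier_mat n m" "A' \<in> carrier_mat n m"
  shows "A = A'"
proof (rule eq_matI)
  fix i j assume ij: "i < dim_row A'" "j < dim_col A'"
  have "four_block_mat A B C D $$ (i, j) = four_block_mat A' B' C' D' $$ (i, j)" using assms(1) by simp
  then show "A $$ (i, j) = A' $$ (i, j)" using ij assms(2,3) by simp
qed (use assms in auto)

definition complex_symplectic_form :: "nat \<Rightarrow> complex mat" where
  "complex_symplectic_form g = four_block_mat (0\<^sub>m g g) (1\<^sub>m g) (- 1\<^sub>m g) (0\<^sub>m g g)"

lemma map_standard_symplectic_form:
  "map_mat complex_of_int (standard_symplectic_form g) = complex_symplectic_form g"
  by (rule eq_matI) (auto simp: standard_symplectic_form_def complex_symplectic_form_def)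

lemma complex_symplectic_form_carrier: "complex_symplectic_form g \<in> carrier_mat (2 * g) (2 * g)"
  unfolding complex_symplectic_form_def mult_2 by (intro four_block_carrier_mat) auto

text \<open>The \<open>2g \<times> g\<close> matrix with blocks \<open>P\<close> and \<open>Q\<close>, padded with zero columns to a square matrix so that
  products of block matrices apply.\<close>

abbreviation stack :: "nat \<Rightarrow> complex mat \<Rightarrow> complex mat \<Rightarrow> complex mat" where
  "stack g P Q \<equiv> four_block_mat P (0\<^sub>m g g) Q (0\<^sub>m g g)"

lemma stack_pairing:
  assumes P: "P \<in> carrier_mat g g" and Q: "Q \<in> carrier_mat g g"
    and P': "P' \<in> carrier_mat g g" and Q': "Q' \<in> carrier_mat g g"
  shows "transpose_mat (stack g P' Q') * (complex_symplectic_form g * stack g P Q) =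
    four_block_mat (transpose_mat P' * Q - transpose_mat Q' * P) (0\<^sub>m g g) (0\<^sub>m g g) (0\<^sub>m g g)"
proof -
  have "- 1\<^sub>m g * P = - P"
    using P by (subst uminus_mult_left_mat) auto
  then have J: "complex_symplectic_form g * stack g P Q = stack g Q (- P)"
    unfolding complex_symplectic_form_def using P Q
    by (subst mult_four_block_mat[of _ g g _ g _ g _ _ g _ g]) (auto intro!: cong_four_block_mat)
  have T: "transpose_mat (stack g P' Q') =
      four_block_mat (transpose_mat P') (transpose_mat Q') (0\<^sub>m g g) (0\<^sub>m g g)"
    using P' Q' by (subst transpose_four_block_mat[of _ g g _ g _ g]) auto
  have "transpose_mat Q' * - P = - (transpose_mat Q' * P)"
    using P Q' by (subst uminus_mult_right_mat) auto
  then have M: "transpose_mat P' * Q + transpose_mat Q' * - P = transpose_mat P' * Q - transpose_mat Q' * P"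
    using P Q P' Q' by (simp add: add_uminus_minus_mat[of _ g g])
  show ?thesis
    unfolding J T using P Q P' Q' M
    by (subst mult_four_block_mat[of _ g g _ g _ g _ _ g _ g]) (auto intro!: cong_four_block_mat)
qed

locale modular_action =
  fixes g :: nat and M :: "int mat" and \<tau> :: "complex mat"
  assumes M: "M \<in> siegel_modular_group g" and \<tau>: "\<tau> \<in> siegel_upper_half_space g"
begin

abbreviation "cM \<equiv> map_mat complex_of_int M"

definition "A = fst (split_block cM g g)"
definition "B = fst (snd (split_block cM g g))"
definition "C = fst (snd (snd (split_block cM g g)))"
definition "D = snd (snd (snd (split_block cM g g)))"

lemma M_carrier: "M \<in> carrier_mat (2 * g) (2 * g)"
  using M by (simp add: siegel_modular_group_def)

lemma split: "split_block cM g g = (A, B, C, D)"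
  by (simp add: A_def B_def C_def D_def)

lemma blocks: "A \<in> carrier_mat g g" "B \<in> carrier_mat g g" "C \<in> carrier_mat g g" "D \<in> carrier_mat g g"
  "cM = four_block_mat A B C D"
  using split_block[OF split, of g g] M_carrier by auto

lemma \<tau>_carrier: "\<tau> \<in> carrier_mat g g"
  using \<tau> by (rule siegel_carrier)

lemma real_blocks:
  "map_mat cnj A = A" "map_mat cnj B = B" "map_mat cnj C = C" "map_mat cnj D = D"
  using M_carrier by (auto simp: A_def B_def C_def D_def split_block_def Let_def intro!: eq_matI)

definition P where "P = A * \<tau> + B"
definition Q where "Q = C * \<tau> + D"

lemma PQ_carrier: "P \<in> carrier_mat g g" "Q \<in> carrier_mat g g"
  using blocks \<tau>_carrier by (auto simp: P_def Q_def)

lemma cM_symplectic: "transpose_mat cM * complex_symplectic_form g * cM = complex_symplectic_form g"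
proof -
  have "map_mat complex_of_int (transpose_mat M * standard_symplectic_form g * M) =
      map_mat complex_of_int (standard_symplectic_form g)"
    using M by (simp add: siegel_modular_group_def)
  moreover have J: "standard_symplectic_form g \<in> carrier_mat (2 * g) (2 * g)"
    unfolding standard_symplectic_form_def mult_2 by (intro four_block_carrier_mat) auto
  moreover have "map_mat complex_of_int (transpose_mat M * standard_symplectic_form g * M) =
      transpose_mat cM * map_mat complex_of_int (standard_symplectic_form g) * cM"
    using M_carrier J
    by (simp add: of_int_hom.mat_hom_mult[of _ "2 * g" "2 * g" _ "2 * g"] map_mat_transpose)
  ultimately show ?thesis by (simp add: map_standard_symplectic_form)
qed

lemma stack_mult:
  assumes "\<sigma> \<in> carrier_mat g g"
  shows "cM * stack g \<sigma> (1\<^sub>m g) = stack g (A * \<sigma> + B) (C * \<sigma> + D)"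
  unfolding blocks(5) using blocks assms
  by (subst mult_four_block_mat[of _ g g _ g _ g _ _ g _ g]) auto

text \<open>Both sides are the symplectic pairing of the columns of \<open>(\<sigma>, 1)\<close> with those of \<open>(\<tau>, 1)\<close>, before and
  after applying \<open>M\<close>. Taking \<open>\<sigma> = \<tau>\<close> gives the symmetry of \<open>M \<cdot> \<tau>\<close>, and \<open>\<sigma> = cnj \<tau>\<close> the
  invertibility of \<open>C \<tau> + D\<close> and the positivity of the imaginary part.\<close>

lemma pairing_invariant:
  assumes \<sigma>: "\<sigma> \<in> carrier_mat g g"
  shows "transpose_mat (A * \<sigma> + B) * Q - transpose_mat (C * \<sigma> + D) * P = transpose_mat \<sigma> - \<tau>"
proof -
  let ?J = "complex_symplectic_form g" and ?Z = "\<lambda>\<sigma>. stack g \<sigma> (1\<^sub>m g)"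
  have J: "?J \<in> carrier_mat (2 * g) (2 * g)" by (rule complex_symplectic_form_carrier)
  have Z: "?Z \<sigma> \<in> carrier_mat (2 * g) (2 * g)" if "\<sigma> \<in> carrier_mat g g" for \<sigma>
    unfolding mult_2 using that by (intro four_block_carrier_mat) auto
  have cM: "cM \<in> carrier_mat (2 * g) (2 * g)" using M_carrier by simp
  have "four_block_mat (transpose_mat (A * \<sigma> + B) * Q - transpose_mat (C * \<sigma> + D) * P) (0\<^sub>m g g) (0\<^sub>m g g) (0\<^sub>m g g) =
      transpose_mat (cM * ?Z \<sigma>) * (?J * (cM * ?Z \<tau>))"
    unfolding stack_mult[OF \<sigma>] stack_mult[OF \<tau>_carrier] P_def[symmetric] Q_def[symmetric]
    using blocks \<sigma> PQ_carrier by (intro stack_pairing[symmetric]) auto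
  also have "transpose_mat (cM * ?Z \<sigma>) = transpose_mat (?Z \<sigma>) * transpose_mat cM"
    by (rule transpose_mult[OF cM Z[OF \<sigma>]])
  also have "transpose_mat (?Z \<sigma>) * transpose_mat cM * (?J * (cM * ?Z \<tau>)) =
      transpose_mat (?Z \<sigma>) * (transpose_mat cM * ?J * cM * ?Z \<tau>)"
    using cM J Z[OF \<sigma>] Z[OF \<tau>_carrier] by (simp add: assoc_mult_mat[of _ "2*g" "2*g" _ "2*g" _ "2*g"])
  also have "\<dots> = transpose_mat (?Z \<sigma>) * (?J * ?Z \<tau>)" unfolding cM_symplectic ..
  also have "\<dots> = four_block_mat (transpose_mat \<sigma> * 1\<^sub>m g - transpose_mat (1\<^sub>m g) * \<tau>) (0\<^sub>m g g) (0\<^sub>m g g) (0\<^sub>m g g)"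
    using \<sigma> \<tau>_carrier by (intro stack_pairing) auto
  finally have "transpose_mat (A * \<sigma> + B) * Q - transpose_mat (C * \<sigma> + D) * P =
      transpose_mat \<sigma> * 1\<^sub>m g - transpose_mat (1\<^sub>m g) * \<tau>"
    by (rule four_block_upper_left_inject[where n = g and m = g]) (use \<sigma> \<tau>_carrier PQ_carrier blocks in auto)
  then show ?thesis using \<sigma> \<tau>_carrier by simp
qed

lemma PQ_symmetric: "transpose_mat P * Q = transpose_mat Q * P"
proof -
  have eq: "transpose_mat P * Q - transpose_mat Q * P = \<tau> - \<tau>"
    using pairing_invariant[OF \<tau>_carrier] siegel_sym[OF \<tau>] by (simp add: P_def Q_def)
  show ?thesis
  proof (rule eq_matI)
    fix i j assume ij: "i < dim_row (transpose_mat Q * P)" "j < dim_col (transpose_mat Q * P)"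
    then have ij': "i < g" "j < g" using PQ_carrier by auto
    have "(transpose_mat P * Q - transpose_mat Q * P) $$ (i, j) = (\<tau> - \<tau>) $$ (i, j)" by (simp only: eq)
    then show "(transpose_mat P * Q) $$ (i, j) = (transpose_mat Q * P) $$ (i, j)"
      using ij ij' PQ_carrier \<tau>_carrier by simp
  qed (use PQ_carrier in auto)
qed

lemma map_cnj_affine:
  assumes "X \<in> carrier_mat g g" "Y \<in> carrier_mat g g" "map_mat cnj X = X" "map_mat cnj Y = Y"
  shows "X * map_mat cnj \<tau> + Y = map_mat cnj (X * \<tau> + Y)"
proof (rule eq_matI)
  fix i j assume "i < dim_row (map_mat cnj (X * \<tau> + Y))" "j < dim_col (map_mat cnj (X * \<tau> + Y))"
  then have ij: "i < g" "j < g" using assms by auto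
  have cX: "cnj (X $$ (i, l)) = X $$ (i, l)" if "l < g" for l
    using assms(1) arg_cong[OF assms(3), of "\<lambda>Z. Z $$ (i, l)"] ij that by simp
  have cY: "cnj (Y $$ (i, j)) = Y $$ (i, j)"
    using assms(2) arg_cong[OF assms(4), of "\<lambda>Z. Z $$ (i, j)"] ij by simp
  show "(X * map_mat cnj \<tau> + Y) $$ (i, j) = map_mat cnj (X * \<tau> + Y) $$ (i, j)"
    using ij assms(1,2) \<tau>_carrier by (simp add: scalar_prod_def cX cY)
qed (use assms \<tau>_carrier in auto)

lemma cnj_mult_mat_vec:
  assumes "X \<in> carrier_mat g g" "w \<in> carrier_vec g"
  shows "map_mat cnj X *\<^sub>v map_vec cnj w = map_vec cnj (X *\<^sub>v w)"
  using assms by (intro eq_vecI) (auto simp: scalar_prod_def)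

text \<open>This is the relation of \<open>pairing_invariant\<close> for \<open>\<sigma> = cnj \<tau>\<close>, evaluated as a Hermitian form at \<open>w\<close>:
  there \<open>cnj \<tau> - \<tau> = - 2\<i> Im \<tau>\<close>.\<close>

lemma hermitian_pairing:
  assumes w: "w \<in> carrier_vec g"
  shows "map_vec cnj (P *\<^sub>v w) \<bullet> (Q *\<^sub>v w) - map_vec cnj (Q *\<^sub>v w) \<bullet> (P *\<^sub>v w) =
    - 2 * \<i> * (map_vec cnj w \<bullet> (map_mat complex_of_real (map_mat Im \<tau>) *\<^sub>v w))"
proof -
  let ?c = "map_mat cnj"
  have cw: "map_vec cnj w \<in> carrier_vec g" using w by simp
  have c\<tau>: "?c \<tau> \<in> carrier_mat g g" using \<tau>_carrier by simp
  have cP: "A * ?c \<tau> + B = ?c P" "C * ?c \<tau> + D = ?c Q"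
    unfolding P_def Q_def by (intro map_cnj_affine blocks real_blocks)+
  have pair: "map_vec cnj w \<bullet> (transpose_mat (?c X) * Y *\<^sub>v w) = map_vec cnj (X *\<^sub>v w) \<bullet> (Y *\<^sub>v w)"
    if "X \<in> carrier_mat g g" "Y \<in> carrier_mat g g" for X Y
  proof -
    have "transpose_mat (?c X) * Y *\<^sub>v w = transpose_mat (?c X) *\<^sub>v (Y *\<^sub>v w)"
      by (rule assoc_mult_mat_vec[of _ g g _ g]) (use that w in auto)
    moreover have "map_vec cnj w \<bullet> (transpose_mat (?c X) *\<^sub>v (Y *\<^sub>v w)) =
        (transpose_mat (transpose_mat (?c X)) *\<^sub>v map_vec cnj w) \<bullet> (Y *\<^sub>v w)"
      by (rule transpose_vec_mult_scalar[of _ g g, symmetric]) (use that w in auto)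
    ultimately show ?thesis using cnj_mult_mat_vec[OF that(1) w] by simp
  qed
  have "map_vec cnj (P *\<^sub>v w) \<bullet> (Q *\<^sub>v w) - map_vec cnj (Q *\<^sub>v w) \<bullet> (P *\<^sub>v w) =
      map_vec cnj w \<bullet> ((transpose_mat (?c P) * Q - transpose_mat (?c Q) * P) *\<^sub>v w)"
  proof -
    have carrier: "transpose_mat (?c P) * Q \<in> carrier_mat g g" "transpose_mat (?c Q) * P \<in> carrier_mat g g"
      using PQ_carrier by (auto intro: mult_carrier_mat)
    show ?thesis
      unfolding minus_mult_distrib_mat_vec[OF carrier w]
        scalar_prod_minus_distrib[OF cw mult_mat_vec_carrier[OF carrier(1) w] mult_mat_vec_carrier[OF carrier(2) w]]
        pair[OF PQ_carrier] pair[OF PQ_carrier(2,1)] ..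
  qed
  also have "transpose_mat (?c P) * Q - transpose_mat (?c Q) * P = transpose_mat (?c \<tau>) - \<tau>"
    using pairing_invariant[OF c\<tau>] unfolding cP .
  also have "transpose_mat (?c \<tau>) - \<tau> = (- 2 * \<i>) \<cdot>\<^sub>m map_mat complex_of_real (map_mat Im \<tau>)"
  proof (rule eq_matI)
    fix i j assume "i < dim_row ((- 2 * \<i>) \<cdot>\<^sub>m map_mat complex_of_real (map_mat Im \<tau>))"
      "j < dim_col ((- 2 * \<i>) \<cdot>\<^sub>m map_mat complex_of_real (map_mat Im \<tau>))"
    then have ij: "i < g" "j < g" using \<tau>_carrier by auto
    have "\<tau> $$ (j, i) = \<tau> $$ (i, j)"
      using arg_cong[OF siegel_sym[OF \<tau>], of "\<lambda>Z. Z $$ (i, j)"] ij \<tau>_carrier by simp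
    then show "(transpose_mat (?c \<tau>) - \<tau>) $$ (i, j) = ((- 2 * \<i>) \<cdot>\<^sub>m map_mat complex_of_real (map_mat Im \<tau>)) $$ (i, j)"
      using ij \<tau>_carrier by (simp add: complex_eq_iff)
  qed (use \<tau>_carrier in auto)
  also have "map_vec cnj w \<bullet> (\<dots> *\<^sub>v w) =
      - 2 * \<i> * (map_vec cnj w \<bullet> (map_mat complex_of_real (map_mat Im \<tau>) *\<^sub>v w))"
    using w \<tau>_carrier by (simp add: scalar_prod_def sum_distrib_left algebra_simps)
  finally show ?thesis .
qed

lemma Im_\<tau>_pos:
  "w \<in> carrier_vec g \<Longrightarrow> w \<noteq> 0\<^sub>v g \<Longrightarrow>
    Re (map_vec cnj w \<bullet> (map_mat complex_of_real (map_mat Im \<tau>) *\<^sub>v w)) > 0"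
  by (rule hermitian_form_pos[OF siegel_imp_positive_definite[OF \<tau>]])

lemma Q_inverse:
  obtains U where "mat_inverse Q = Some U" "U \<in> carrier_mat g g" "Q * U = 1\<^sub>m g" "U * Q = 1\<^sub>m g"
proof (rule mat_inverse_exists[OF PQ_carrier(2)])
  fix w assume w: "w \<in> carrier_vec g" "Q *\<^sub>v w = 0\<^sub>v g"
  have "map_vec cnj (0\<^sub>v g) = 0\<^sub>v g" by auto
  then have "map_vec cnj w \<bullet> (map_mat complex_of_real (map_mat Im \<tau>) *\<^sub>v w) = 0"
    using hermitian_pairing[OF w(1)] PQ_carrier w by simp
  then show "w = 0\<^sub>v g" using Im_\<tau>_pos[OF w(1)] by fastforce
qed (use that in blast)

lemma siegel_action_eq: "siegel_action g M \<tau> = P * the (mat_inverse Q)"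
  by (simp add: siegel_action_def split P_def Q_def)

text \<open>Write \<open>\<tau>'\<close> for \<open>M \<cdot> \<tau>\<close>. Since \<open>P = \<tau>' Q\<close>, symmetry of \<open>\<^sup>tP Q\<close> gives that of \<open>\<tau>'\<close>. For real \<open>v = Q w\<close> the Hermitian pairing at \<open>w\<close>
  identifies \<open>\<^sup>tv (Im \<tau>') v\<close> with the positive Hermitian form of \<open>Im \<tau>\<close> at \<open>w\<close>.\<close>

lemma siegel_action_in_siegel: "siegel_action g M \<tau> \<in> siegel_upper_half_space g"
proof -
  obtain U where U: "mat_inverse Q = Some U" "U \<in> carrier_mat g g" "Q * U = 1\<^sub>m g" "U * Q = 1\<^sub>m g"
    using Q_inverse by blast
  define \<tau>' where "\<tau>' = P * U"
  have \<tau>': "\<tau>' \<in> carrier_mat g g" using PQ_carrier U by (simp add: \<tau>'_def)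
  note assoc = assoc_mult_mat[of _ g g _ g _ g]
  have "transpose_mat \<tau>' = transpose_mat U * transpose_mat P"
    unfolding \<tau>'_def by (rule transpose_mult[OF PQ_carrier(1) U(2)])
  also have "\<dots> = transpose_mat U * (transpose_mat P * (Q * U))"
    using PQ_carrier U by simp
  also have "\<dots> = transpose_mat U * (transpose_mat P * Q * U)"
    using PQ_carrier U by (simp add: assoc)
  also have "\<dots> = transpose_mat U * transpose_mat Q * (P * U)"
    unfolding PQ_symmetric using PQ_carrier U by (simp add: assoc)
  also have "transpose_mat U * transpose_mat Q = 1\<^sub>m g"
    using transpose_mult[OF PQ_carrier(2) U(2)] U(3) by simp
  finally have sym: "transpose_mat \<tau>' = \<tau>'" using left_mult_one_mat[OF \<tau>'] unfolding \<tau>'_def by simp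
  have pos: "v \<bullet> (map_mat Im \<tau>' *\<^sub>v v) > 0" if v: "v \<in> carrier_vec g" "v \<noteq> 0\<^sub>v g" for v :: "real vec"
  proof -
    define z where "z = map_vec complex_of_real v"
    define w where "w = U *\<^sub>v z"
    have z: "z \<in> carrier_vec g" and cz: "map_vec cnj z = z" using v by (auto simp: z_def)
    have w: "w \<in> carrier_vec g" using U z by (simp add: w_def)
    have Qw: "Q *\<^sub>v w = z"
      using assoc_mult_mat_vec[OF PQ_carrier(2) U(2) z] U(3) z by (simp add: w_def)
    have Pw: "P *\<^sub>v w = \<tau>' *\<^sub>v z"
      using assoc_mult_mat_vec[OF PQ_carrier(1) U(2) z] by (simp add: w_def \<tau>'_def)
    have "w \<noteq> 0\<^sub>v g"
    proof
      assume "w = 0\<^sub>v g"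
      moreover have "Q *\<^sub>v 0\<^sub>v g = 0\<^sub>v g" using PQ_carrier by (intro eq_vecI) auto
      ultimately have z0: "z = 0\<^sub>v g" using Qw by simp
      have "v = 0\<^sub>v g"
      proof (rule eq_vecI)
        fix l assume "l < dim_vec (0\<^sub>v g :: real vec)"
        then show "v $ l = 0\<^sub>v g $ l"
          using arg_cong[OF z0, of "\<lambda>u. u $ l"] v(1) by (simp add: z_def)
      qed (use v in auto)
      then show False using v by simp
    qed
    then have "0 < Re (map_vec cnj w \<bullet> (map_mat complex_of_real (map_mat Im \<tau>) *\<^sub>v w))"
      by (rule Im_\<tau>_pos[OF w])
    also have "\<dots> = - Im (map_vec cnj (\<tau>' *\<^sub>v z) \<bullet> z - z \<bullet> (\<tau>' *\<^sub>v z)) / 2"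
      using hermitian_pairing[OF w] unfolding Pw Qw cz by simp
    also have "map_vec cnj (\<tau>' *\<^sub>v z) \<bullet> z = cnj (z \<bullet> (\<tau>' *\<^sub>v z))"
      using v \<tau>' by (auto simp: z_def scalar_prod_def mult.commute intro!: sum.cong)
    also have "- Im (cnj (z \<bullet> (\<tau>' *\<^sub>v z)) - z \<bullet> (\<tau>' *\<^sub>v z)) / 2 = Im (z \<bullet> (\<tau>' *\<^sub>v z))"
      by simp
    also have "\<dots> = v \<bullet> (map_mat Im \<tau>' *\<^sub>v v)"
      using v \<tau>' by (auto simp: z_def scalar_prod_def intro!: sum.cong)
    finally show ?thesis .
  qed
  have "siegel_action g M \<tau> = \<tau>'" by (simp add: siegel_action_eq U \<tau>'_def)
  then show ?thesis using \<tau>' sym pos by (simp add: siegel_upper_half_space_def)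
qed

end

lemma split_block_four_block_mat:
  assumes "A \<in> carrier_mat n m" "B \<in> carrier_mat n m'" "C \<in> carrier_mat n' m" "D \<in> carrier_mat n' m'"
  shows "split_block (four_block_mat A B C D) n m = (A, B, C, D)"
  using assms unfolding split_block_def Let_def by (auto intro!: eq_matI)

definition translation :: "nat \<Rightarrow> int mat \<Rightarrow> int mat" where
  "translation g S = four_block_mat (1\<^sub>m g) S (0\<^sub>m g g) (1\<^sub>m g)"

lemma translation_symplectic:
  assumes S: "S \<in> carrier_mat g g" "transpose_mat S = S"
  shows "transpose_mat (translation g S) * standard_symplectic_form g * translation g S = standard_symplectic_form g"
proof -
  have T: "transpose_mat (translation g S) = four_block_mat (1\<^sub>m g) (0\<^sub>m g g) S (1\<^sub>m g)"
    unfolding translation_def using S by (subst transpose_four_block_mat[of _ g g _ g _ g]) auto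
  have TJ: "transpose_mat (translation g S) * standard_symplectic_form g =
      four_block_mat (0\<^sub>m g g) (1\<^sub>m g) (- 1\<^sub>m g) S"
    unfolding T standard_symplectic_form_def using S
    by (subst mult_four_block_mat[of _ g g _ g _ g _ _ g _ g]) (auto intro!: cong_four_block_mat)
  have "- 1\<^sub>m g * S + S = 0\<^sub>m g g"
  proof -
    have "- 1\<^sub>m g * S = - S" using S by (subst uminus_mult_left_mat) auto
    then show ?thesis using S by simp
  qed
  then show ?thesis
    unfolding TJ unfolding translation_def standard_symplectic_form_def using S
    by (subst mult_four_block_mat[of _ g g _ g _ g _ _ g _ g]) (auto intro!: cong_four_block_mat)
qed

lemma translation_carrier: "S \<in> carrier_mat g g \<Longrightarrow> translation g S \<in> carrier_mat (2 * g) (2 * g)"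
  unfolding translation_def mult_2 by (intro four_block_carrier_mat) auto

lemma translation_mult_in_modular_group:
  assumes S: "S \<in> carrier_mat g g" "transpose_mat S = S" and M: "M \<in> siegel_modular_group g"
  shows "translation g S * M \<in> siegel_modular_group g"
proof -
  let ?T = "translation g S" and ?J = "standard_symplectic_form g"
  have T: "?T \<in> carrier_mat (2 * g) (2 * g)" by (rule translation_carrier[OF S(1)])
  have J: "?J \<in> carrier_mat (2 * g) (2 * g)"
    unfolding standard_symplectic_form_def mult_2 by (intro four_block_carrier_mat) auto
  have Mc: "M \<in> carrier_mat (2 * g) (2 * g)" and MJ: "transpose_mat M * ?J * M = ?J"
    using M by (auto simp: siegel_modular_group_def)
  note assoc = assoc_mult_mat[of _ "2*g" "2*g" _ "2*g" _ "2*g"]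
  have "transpose_mat (?T * M) * ?J * (?T * M) = transpose_mat M * (transpose_mat ?T * ?J * ?T) * M"
    using T J Mc by (simp add: transpose_mult[of _ "2*g" "2*g" _ "2*g"] assoc)
  then show ?thesis
    using T Mc MJ by (simp add: translation_symplectic[OF S] siegel_modular_group_def)
qed

lemma siegel_action_translation:
  assumes S: "S \<in> carrier_mat g g" and M: "M \<in> siegel_modular_group g" and \<tau>: "\<tau> \<in> siegel_upper_half_space g"
  shows "siegel_action g (translation g S * M) \<tau> = siegel_action g M \<tau> + map_mat of_int S"
proof -
  interpret modular_action g M \<tau> using M \<tau> by unfold_locales
  define R where "R = map_mat complex_of_int S"
  have R: "R \<in> carrier_mat g g" using S by (simp add: R_def)
  have "map_mat complex_of_int (translation g S * M) = map_mat complex_of_int (translation g S) * cM"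
    using translation_carrier[OF S] M_carrier by (rule of_int_hom.mat_hom_mult)
  also have "map_mat complex_of_int (translation g S) = four_block_mat (1\<^sub>m g) R (0\<^sub>m g g) (1\<^sub>m g)"
    unfolding translation_def R_def using S by (subst map_four_block_mat[of _ g g _ g _ g]) (auto intro!: cong_four_block_mat eq_matI)
  also have "four_block_mat (1\<^sub>m g) R (0\<^sub>m g g) (1\<^sub>m g) * cM = four_block_mat (A + R * C) (B + R * D) C D"
    unfolding blocks(5) using blocks(1-4) R
    by (subst mult_four_block_mat[of _ g g _ g _ g _ _ g _ g]) (auto intro!: cong_four_block_mat)
  finally have "split_block (map_mat complex_of_int (translation g S * M)) g g = (A + R * C, B + R * D, C, D)"
    using blocks R by (simp add: split_block_four_block_mat[of _ g g _ g _ g])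
  then have act: "siegel_action g (translation g S * M) \<tau> = ((A + R * C) * \<tau> + (B + R * D)) * the (mat_inverse Q)"
    by (simp add: siegel_action_def Q_def)
  have RC: "R * C \<in> carrier_mat g g" "R * D \<in> carrier_mat g g" "A * \<tau> \<in> carrier_mat g g" "C * \<tau> \<in> carrier_mat g g"
    "R * C * \<tau> \<in> carrier_mat g g" "R * Q \<in> carrier_mat g g"
    using blocks R \<tau>_carrier PQ_carrier by auto
  have "(A + R * C) * \<tau> + (B + R * D) = (A * \<tau> + R * C * \<tau>) + (B + R * D)"
    using add_mult_distrib_mat[OF blocks(1) RC(1) \<tau>_carrier] by simp
  also have "\<dots> = P + (R * C * \<tau> + R * D)"
  proof -
    have "(A * \<tau> + R * C * \<tau>) + (B + R * D) = (A * \<tau> + B) + (R * C * \<tau> + R * D)"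
      using blocks RC by (intro eq_matI) (auto simp: algebra_simps)
    then show ?thesis by (simp add: P_def)
  qed
  also have "R * C * \<tau> + R * D = R * Q"
    unfolding Q_def using mult_add_distrib_mat[OF R RC(4) blocks(4)] assoc_mult_mat[OF R blocks(3) \<tau>_carrier] by simp
  finally have PR: "(A + R * C) * \<tau> + (B + R * D) = P + R * Q" .
  obtain U where U: "mat_inverse Q = Some U" "U \<in> carrier_mat g g" "Q * U = 1\<^sub>m g" "U * Q = 1\<^sub>m g"
    using Q_inverse by blast
  have "(P + R * Q) * U = P * U + R * Q * U"
    by (rule add_mult_distrib_mat[OF PQ_carrier(1) RC(6) U(2)])
  also have "R * Q * U = R"
    using assoc_mult_mat[OF R PQ_carrier(2) U(2)] U(3) R by simp
  finally show ?thesis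
    unfolding act PR siegel_action_eq by (simp add: U R_def)
qed

text \<open>Positivity on a diagonal block is positivity on the vectors supported in that block.\<close>

lemma siegel_block_diagonal:
  assumes \<tau>: "four_block_mat \<tau>1 (0\<^sub>m k l) (0\<^sub>m l k) \<tau>2 \<in> siegel_upper_half_space (k + l)"
    and c: "\<tau>1 \<in> carrier_mat k k" "\<tau>2 \<in> carrier_mat l l"
  shows "\<tau>1 \<in> siegel_upper_half_space k" and "\<tau>2 \<in> siegel_upper_half_space l"
proof -
  let ?Y = "\<lambda>\<tau>. map_mat Im \<tau>"
  have "four_block_mat (transpose_mat \<tau>1) (0\<^sub>m k l) (0\<^sub>m l k) (transpose_mat \<tau>2) = four_block_mat \<tau>1 (0\<^sub>m k l) (0\<^sub>m l k) \<tau>2"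
    using siegel_sym[OF \<tau>] c by (subst (asm) transpose_four_block_mat[of _ k k _ l _ l]) auto
  from arg_cong[OF this, of "\<lambda>Z. split_block Z k k"]
  have sym: "transpose_mat \<tau>1 = \<tau>1" "transpose_mat \<tau>2 = \<tau>2"
    using c by (simp_all add: split_block_four_block_mat[of _ k k _ l _ l])
  have Y: "?Y (four_block_mat \<tau>1 (0\<^sub>m k l) (0\<^sub>m l k) \<tau>2) = four_block_mat (?Y \<tau>1) (0\<^sub>m k l) (0\<^sub>m l k) (?Y \<tau>2)"
    using c by (subst map_four_block_mat[of _ k k _ l _ l]) (auto intro!: cong_four_block_mat eq_matI)
  have form: "(v @\<^sub>v w) \<bullet> (?Y (four_block_mat \<tau>1 (0\<^sub>m k l) (0\<^sub>m l k) \<tau>2) *\<^sub>v (v @\<^sub>v w)) =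
      v \<bullet> (?Y \<tau>1 *\<^sub>v v) + w \<bullet> (?Y \<tau>2 *\<^sub>v w)"
    if "v \<in> carrier_vec k" "w \<in> carrier_vec l" for v w
  proof -
    have "four_block_mat (?Y \<tau>1) (0\<^sub>m k l) (0\<^sub>m l k) (?Y \<tau>2) *\<^sub>v (v @\<^sub>v w) = (?Y \<tau>1 *\<^sub>v v) @\<^sub>v (?Y \<tau>2 *\<^sub>v w)"
      using c that by (intro mult_mat_vec_split) auto
    then show ?thesis
      unfolding Y using c that by (simp add: scalar_prod_append[of _ k _ l])
  qed
  have pos: "(v @\<^sub>v w) \<bullet> (?Y (four_block_mat \<tau>1 (0\<^sub>m k l) (0\<^sub>m l k) \<tau>2) *\<^sub>v (v @\<^sub>v w)) > 0"
    if "v \<in> carrier_vec k" "w \<in> carrier_vec l" "v \<noteq> 0\<^sub>v k \<or> w \<noteq> 0\<^sub>v l" for v w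
  proof -
    have "0\<^sub>v (k + l) = (0\<^sub>v k @\<^sub>v 0\<^sub>v l :: real vec)" by auto
    then have "v @\<^sub>v w \<noteq> 0\<^sub>v (k + l)"
      using that append_vec_eq[OF that(1), of "0\<^sub>v k" w "0\<^sub>v l"] by auto
    then show ?thesis
      using \<tau> that(1,2) unfolding siegel_upper_half_space_def by auto
  qed
  have "v \<bullet> (?Y \<tau>1 *\<^sub>v v) > 0" if "v \<in> carrier_vec k" "v \<noteq> 0\<^sub>v k" for v
    using pos[of v "0\<^sub>v l"] form[of v "0\<^sub>v l"] that c by simp
  then show "\<tau>1 \<in> siegel_upper_half_space k"
    using c sym by (simp add: siegel_upper_half_space_def)
  have "w \<bullet> (?Y \<tau>2 *\<^sub>v w) > 0" if "w \<in> carrier_vec l" "w \<noteq> 0\<^sub>v l" for w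
    using pos[of "0\<^sub>v k" w] form[of "0\<^sub>v k" w] that c by simp
  then show "\<tau>2 \<in> siegel_upper_half_space l"
    using c sym by (simp add: siegel_upper_half_space_def)
qed

section \<open>Theta series and their addition formula\<close>

locale siegel_point =
  fixes g :: nat and \<tau> :: "complex mat"
  assumes siegel: "\<tau> \<in> siegel_upper_half_space g"
begin

lemma \<tau>_sym: "i < g \<Longrightarrow> j < g \<Longrightarrow> \<tau> $$ (i, j) = \<tau> $$ (j, i)"
  using siegel_carrier[OF siegel] siegel_sym[OF siegel]
  by (metis carrier_matD index_transpose_mat(1))

definition bilinear :: "int vec \<Rightarrow> int vec \<Rightarrow> complex" where
  "bilinear U V = (\<Sum>i<g. \<Sum>j<g. \<tau> $$ (i, j) * of_int (U $ i) * of_int (V $ j))"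

lemma bilinear_add_left: "U \<in> lattice g \<Longrightarrow> U' \<in> lattice g \<Longrightarrow> bilinear (U + U') V = bilinear U V + bilinear U' V"
  by (simp add: bilinear_def sum.distrib algebra_simps)

lemma bilinear_add_right: "V \<in> lattice g \<Longrightarrow> V' \<in> lattice g \<Longrightarrow> bilinear U (V + V') = bilinear U V + bilinear U V'"
  by (simp add: bilinear_def sum.distrib algebra_simps)

lemma bilinear_diff_left: "U \<in> lattice g \<Longrightarrow> U' \<in> lattice g \<Longrightarrow> bilinear (U - U') V = bilinear U V - bilinear U' V"
  by (simp add: bilinear_def sum_subtractf algebra_simps)

lemma bilinear_diff_right: "V \<in> lattice g \<Longrightarrow> V' \<in> lattice g \<Longrightarrow> bilinear U (V - V') = bilinear U V - bilinear U V'"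
  by (simp add: bilinear_def sum_subtractf algebra_simps)

lemma bilinear_commute: "bilinear U V = bilinear V U"
  unfolding bilinear_def by (subst sum.swap) (auto intro!: sum.cong simp: \<tau>_sym)

definition gaussian :: "real \<Rightarrow> int vec \<Rightarrow> complex" where
  "gaussian c U = exp (of_real pi * \<i> * of_real c * bilinear U U)"

text \<open>The parallelogram law for the quadratic form of \<open>\<tau>\<close>.\<close>

lemma gaussian_mult_gaussian:
  assumes "N \<in> lattice g" "d \<in> lattice g"
  shows "gaussian (1/4) (N + d) * gaussian (1/4) (N - d) = gaussian (1/2) N * gaussian (1/2) d"
proof -
  have "bilinear (N + d) (N + d) + bilinear (N - d) (N - d) = 2 * (bilinear N N + bilinear d d)"
    using assms by (simp add: bilinear_add_left bilinear_add_right bilinear_diff_left bilinear_diff_right)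
  then have "of_real pi * \<i> * of_real (1/4) * (bilinear (N + d) (N + d) + bilinear (N - d) (N - d))
     = of_real pi * \<i> * of_real (1/2) * (bilinear N N + bilinear d d)"
    by simp
  then show ?thesis
    unfolding gaussian_def exp_add[symmetric] distrib_left[symmetric] by (rule arg_cong)
qed

lemma gaussian_uminus: "U \<in> lattice g \<Longrightarrow> gaussian c (- U) = gaussian c U"
  by (simp add: gaussian_def bilinear_def)

lemma gaussian_rapidly_decreasing:
  assumes "c > 0"
  shows "rapidly_decreasing g (lattice g) (gaussian c)"
proof -
  obtain \<kappa> where \<kappa>: "\<kappa> > 0"
    "\<And>v. v \<in> carrier_vec g \<Longrightarrow> \<kappa> * (\<Sum>i<g. (v $ i)\<^sup>2) \<le> v \<bullet> (map_mat Im \<tau> *\<^sub>v v)"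
    using positive_definite.lower_bound[OF siegel_imp_positive_definite[OF siegel]] by blast
  have dim: "dim_row \<tau> = g" "dim_col \<tau> = g" using siegel_carrier[OF siegel] by auto
  show ?thesis
  proof (rule rapidly_decreasing_gaussian[of "pi * c * \<kappa>"])
    show "pi * c * \<kappa> > 0" using assms \<kappa> by simp
    fix U assume U: "U \<in> lattice g"
    define v where "v = map_vec real_of_int U"
    have v: "v \<in> carrier_vec g" using U by (simp add: v_def)
    have "Im (bilinear U U) = v \<bullet> (map_mat Im \<tau> *\<^sub>v v)"
      using U dim by (auto simp: bilinear_def v_def scalar_prod_def lessThan_atLeast0 sum_distrib_left intro!: sum.cong)
    then have "\<kappa> * (\<Sum>i<g. (real_of_int (U $ i))\<^sup>2) \<le> Im (bilinear U U)"
      using \<kappa>(2)[OF v] U by (simp add: v_def)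
    then have "(pi * c) * (\<kappa> * (\<Sum>i<g. (real_of_int (U $ i))\<^sup>2)) \<le> (pi * c) * Im (bilinear U U)"
      using assms by (intro mult_left_mono) auto
    then show "norm (gaussian c U) \<le> exp (- (pi * c * \<kappa>) * (\<Sum>i<g. (real_of_int (U $ i))\<^sup>2))"
      by (simp add: gaussian_def norm_exp_eq_Re mult.assoc)
  qed
qed

text \<open>With \<open>U = 2m + \<epsilon>\<close> this is the term of \<open>\<theta>[\<epsilon>,\<delta>](\<tau>,z)\<close> at \<open>m\<close>, where \<open>y = z + \<delta>/2\<close>.\<close>

definition theta_term :: "(nat \<Rightarrow> complex) \<Rightarrow> int vec \<Rightarrow> complex" where
  "theta_term y U = exp (of_real pi * \<i> * linear_form g y U) * gaussian (1/4) U"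

text \<open>The weight \<open>p\<close> is a polynomial in \<open>U\<close>; the weight \<open>linear_form g a\<close> corresponds to the derivative in
  the direction \<open>a\<close>, up to the factor \<open>\<pi>\<i>\<close>.\<close>

definition theta_series :: "int vec \<Rightarrow> (int vec \<Rightarrow> complex) \<Rightarrow> (nat \<Rightarrow> complex) \<Rightarrow> complex" where
  "theta_series \<epsilon> p y = (\<Sum>\<^sub>\<infinity>U\<in>coset g \<epsilon>. p U * theta_term y U)"

lemma theta_term_rapidly_decreasing: "rapidly_decreasing g (lattice g) (theta_term y)"
  unfolding theta_term_def
  by (intro rapidly_decreasing_exp_linear_form gaussian_rapidly_decreasing) simp

lemma weighted_term_rapidly_decreasing:
  "moderate_growth g p \<Longrightarrow> rapidly_decreasing g (coset g \<epsilon>) (\<lambda>U. p U * theta_term y U)"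
  using rapidly_decreasing_moderate[OF theta_term_rapidly_decreasing] rapidly_decreasing_subset[OF _ coset_subset]
  by blast

lemma theta_term_mult:
  assumes "N \<in> lattice g" "d \<in> lattice g"
  shows "theta_term y (N + d) * theta_term y (N - d) =
    exp (of_real (2 * pi) * \<i> * linear_form g y N) * (gaussian (1/2) N * gaussian (1/2) d)"
proof -
  have "theta_term y (N + d) * theta_term y (N - d) =
      exp (of_real pi * \<i> * linear_form g y (N + d)) * exp (of_real pi * \<i> * linear_form g y (N - d)) *
      (gaussian (1/4) (N + d) * gaussian (1/4) (N - d))"
    by (simp only: theta_term_def mult_ac)
  also have "exp (of_real pi * \<i> * linear_form g y (N + d)) * exp (of_real pi * \<i> * linear_form g y (N - d)) =
      exp (of_real (2 * pi) * \<i> * linear_form g y N)"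
    using assms by (simp add: linear_form_add linear_form_diff algebra_simps flip: exp_add)
  finally show ?thesis unfolding gaussian_mult_gaussian[OF assms] .
qed

text \<open>Pairs \<open>(U, V)\<close> of vectors in the class of \<open>\<epsilon>\<close> correspond to pairs \<open>(N, d)\<close> with \<open>d \<equiv> N + \<epsilon>\<close> modulo 2
  through \<open>U = N + d\<close>, \<open>V = N - d\<close>. In these variables the Gaussian factors separate, which is the
  source of Riemann's addition formula.\<close>

lemma theta_series_product:
  assumes p: "moderate_growth g p" and q: "moderate_growth g q" and \<epsilon>: "\<epsilon> \<in> lattice g"
  shows "((\<lambda>(N, d). p (N + d) * q (N - d) *
      (exp (of_real (2 * pi) * \<i> * linear_form g y N) * (gaussian (1/2) N * gaussian (1/2) d)))
    has_sum theta_series \<epsilon> p y * theta_series \<epsilon> q y) (Sigma (lattice g) (\<lambda>N. coset g (N + \<epsilon>)))"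
proof -
  note ap = rapidly_decreasing_abs_summable[OF weighted_term_rapidly_decreasing[OF p, of \<epsilon> y]]
    and aq = rapidly_decreasing_abs_summable[OF weighted_term_rapidly_decreasing[OF q, of \<epsilon> y]]
  have "((\<lambda>(U, V). (p U * theta_term y U) * (q V * theta_term y V)) has_sum
      theta_series \<epsilon> p y * theta_series \<epsilon> q y) (coset g \<epsilon> \<times> coset g \<epsilon>)"
    unfolding theta_series_def infsum_mult_infsum(2)[OF ap aq]
    using abs_summable_summable[OF infsum_mult_infsum(1)[OF ap aq]] by (rule has_sum_infsum)
  also have "?this \<longleftrightarrow> ?thesis"
  proof (rule has_sum_reindex_bij_witness[where i = "\<lambda>(N, d). (N + d, N - d)"
        and j = "\<lambda>(U, V). (vec g (\<lambda>i. (U $ i + V $ i) div 2), vec g (\<lambda>i. (U $ i - V $ i) div 2))"], goal_cases)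
    case (1 a)
    obtain U V where a: "a = (U, V)" by (cases a)
    have UV: "U \<in> lattice g" "V \<in> lattice g" "\<And>i. i < g \<Longrightarrow> even (U $ i - V $ i)"
      using 1 coset_subset coset_diff_even unfolding a by blast+
    have "(U $ i + V $ i) div 2 + (U $ i - V $ i) div 2 = U $ i"
      "(U $ i + V $ i) div 2 - (U $ i - V $ i) div 2 = V $ i" if "i < g" for i
      using UV(3)[OF that] by presburger+
    then show ?case using UV(1,2) by (auto simp: a intro!: eq_vecI)
  next
    case (2 a)
    obtain U V where a: "a = (U, V)" by (cases a)
    have "even ((U $ i - V $ i) div 2 - ((U $ i + V $ i) div 2 + \<epsilon> $ i))"
      if "i < g" "even (U $ i - \<epsilon> $ i)" "even (V $ i - \<epsilon> $ i)" for i
      using that by presburger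
    then show ?case using 2 \<epsilon> by (auto simp: a coset_def)
  next
    case (3 b)
    obtain N d where b: "b = (N, d)" by (cases b)
    show ?case using 3 by (auto simp: b coset_def intro!: eq_vecI)
  next
    case (4 b)
    obtain N d where b: "b = (N, d)" by (cases b)
    have "even (N $ i + d $ i - \<epsilon> $ i)" "even (N $ i - d $ i - \<epsilon> $ i)"
      if "i < g" "even (d $ i - (N $ i + \<epsilon> $ i))" for i
      using that by presburger+
    then show ?case using 4 \<epsilon> by (auto simp: b coset_def)
  next
    case (5 a)
    obtain U V where a: "a = (U, V)" by (cases a)
    define N d where "N = vec g (\<lambda>i. (U $ i + V $ i) div 2)" and "d = vec g (\<lambda>i. (U $ i - V $ i) div 2)"
    have UV: "U \<in> lattice g" "V \<in> lattice g" "\<And>i. i < g \<Longrightarrow> even (U $ i - V $ i)"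
      using 5 coset_subset coset_diff_even unfolding a by blast+
    have "(U $ i + V $ i) div 2 + (U $ i - V $ i) div 2 = U $ i"
      "(U $ i + V $ i) div 2 - (U $ i - V $ i) div 2 = V $ i" if "i < g" for i
      using UV(3)[OF that] by presburger+
    then have Nd: "N \<in> lattice g" "d \<in> lattice g" "U = N + d" "V = N - d"
      using UV(1,2) by (auto simp: N_def d_def intro!: eq_vecI)
    have "(p U * theta_term y U) * (q V * theta_term y V) = p (N + d) * q (N - d) * (theta_term y (N + d) * theta_term y (N - d))"
      by (simp add: Nd)
    then show ?case unfolding a prod.case N_def[symmetric] d_def[symmetric] theta_term_mult[OF Nd(1,2)] by simp
  qed (rule refl)
  finally show ?thesis .
qed

text \<open>The second order theta constants: the value at \<open>0\<close> of the theta series of \<open>2\<tau>\<close> with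
  characteristic \<open>[\<sigma>, 0]\<close>.\<close>

definition theta_null :: "int vec \<Rightarrow> complex" where
  "theta_null \<sigma> = (\<Sum>\<^sub>\<infinity>d\<in>coset g \<sigma>. gaussian (1/2) d)"

text \<open>Up to a constant factor, the second derivative at \<open>0\<close> in the directions \<open>a\<close> and \<open>b\<close> of the theta
  series of \<open>2\<tau>\<close> with characteristic \<open>[\<sigma>, 0]\<close>.\<close>

definition theta_null_hessian :: "(nat \<Rightarrow> complex) \<Rightarrow> (nat \<Rightarrow> complex) \<Rightarrow> int vec \<Rightarrow> complex" where
  "theta_null_hessian a b \<sigma> = (\<Sum>\<^sub>\<infinity>d\<in>coset g \<sigma>. (linear_form g a d * linear_form g b d) * gaussian (1/2) d)"

lemma theta_null_has_sum: "(gaussian (1/2) has_sum theta_null \<sigma>) (coset g \<sigma>)"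
  unfolding theta_null_def
  by (intro has_sum_infsum rapidly_decreasing_summable[where g = g] rapidly_decreasing_subset[OF _ coset_subset]
      gaussian_rapidly_decreasing) simp

lemma theta_null_hessian_has_sum:
  "((\<lambda>d. (linear_form g a d * linear_form g b d) * gaussian (1/2) d) has_sum theta_null_hessian a b \<sigma>) (coset g \<sigma>)"
  unfolding theta_null_hessian_def
  by (intro has_sum_infsum rapidly_decreasing_summable[where g = g] rapidly_decreasing_subset[OF _ coset_subset]
      rapidly_decreasing_moderate[OF gaussian_rapidly_decreasing] moderate_growth_mult moderate_growth_linear_form) auto

lemma theta_square:
  assumes \<epsilon>: "\<epsilon> \<in> lattice g"
  shows "((\<lambda>N. exp (of_real (2 * pi) * \<i> * linear_form g y N) * (gaussian (1/2) N * theta_null (N + \<epsilon>)))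
     has_sum (theta_series \<epsilon> (\<lambda>_. 1) y)\<^sup>2) (lattice g)"
proof (rule has_sum_SigmaD)
  show "((\<lambda>(N, d). exp (of_real (2 * pi) * \<i> * linear_form g y N) * (gaussian (1/2) N * gaussian (1/2) d))
    has_sum (theta_series \<epsilon> (\<lambda>_. 1) y)\<^sup>2) (Sigma (lattice g) (\<lambda>N. coset g (N + \<epsilon>)))"
    using theta_series_product[OF moderate_growth_const moderate_growth_const \<epsilon>, of 1 1 y]
    by (simp add: power2_eq_square)
next
  fix N
  show "((\<lambda>d. case (N, d) of (N, d) \<Rightarrow> exp (of_real (2 * pi) * \<i> * linear_form g y N) * (gaussian (1/2) N * gaussian (1/2) d))
    has_sum exp (of_real (2 * pi) * \<i> * linear_form g y N) * (gaussian (1/2) N * theta_null (N + \<epsilon>))) (coset g (N + \<epsilon>))"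
    unfolding prod.case by (intro has_sum_cmult_right theta_null_has_sum)
qed

text \<open>The product is symmetrised in \<open>a\<close> and \<open>b\<close> because
  \<open>(a \<cdot> (N + d)) (b \<cdot> (N - d)) + (b \<cdot> (N + d)) (a \<cdot> (N - d)) = 2 (a \<cdot> N) (b \<cdot> N) - 2 (a \<cdot> d) (b \<cdot> d)\<close>
  has no mixed terms.\<close>

lemma theta_gradient_product:
  assumes \<epsilon>: "\<epsilon> \<in> lattice g"
  shows "((\<lambda>N. exp (of_real (2 * pi) * \<i> * linear_form g y N) * (gaussian (1/2) N *
            (linear_form g a N * linear_form g b N * theta_null (N + \<epsilon>) - theta_null_hessian a b (N + \<epsilon>))))
     has_sum theta_series \<epsilon> (linear_form g a) y * theta_series \<epsilon> (linear_form g b) y) (lattice g)"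
proof (rule has_sum_SigmaD)
  let ?a = "linear_form g a" and ?b = "linear_form g b"
    and ?e = "\<lambda>N. exp (of_real (2 * pi) * \<i> * linear_form g y N)"
  define S where "S = theta_series \<epsilon> ?a y * theta_series \<epsilon> ?b y"
  note prod = theta_series_product[OF moderate_growth_linear_form moderate_growth_linear_form \<epsilon>, of _ _ y]
  have "((\<lambda>x. 1/2 * ((case x of (N, d) \<Rightarrow> ?a (N + d) * ?b (N - d) * (?e N * (gaussian (1/2) N * gaussian (1/2) d)))
     + (case x of (N, d) \<Rightarrow> ?b (N + d) * ?a (N - d) * (?e N * (gaussian (1/2) N * gaussian (1/2) d)))))
     has_sum 1/2 * (S + theta_series \<epsilon> ?b y * theta_series \<epsilon> ?a y)) (Sigma (lattice g) (\<lambda>N. coset g (N + \<epsilon>)))"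
    unfolding S_def by (intro has_sum_cmult_right has_sum_add prod)
  also have "1/2 * (S + theta_series \<epsilon> ?b y * theta_series \<epsilon> ?a y) = S"
    by (simp add: S_def)
  finally show "((\<lambda>(N, d). ?e N * (gaussian (1/2) N * (?a N * ?b N * gaussian (1/2) d - ?a d * ?b d * gaussian (1/2) d)))
     has_sum S) (Sigma (lattice g) (\<lambda>N. coset g (N + \<epsilon>)))"
    by (rule has_sum_cong[THEN iffD1, rotated])
       (use coset_subset in \<open>auto simp: linear_form_add linear_form_diff field_simps subset_iff\<close>)
next
  fix N
  show "((\<lambda>d. case (N, d) of (N, d) \<Rightarrow> exp (of_real (2 * pi) * \<i> * linear_form g y N) * (gaussian (1/2) N *
        (linear_form g a N * linear_form g b N * gaussian (1/2) d - linear_form g a d * linear_form g b d * gaussian (1/2) d)))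
    has_sum exp (of_real (2 * pi) * \<i> * linear_form g y N) * (gaussian (1/2) N *
            (linear_form g a N * linear_form g b N * theta_null (N + \<epsilon>) - theta_null_hessian a b (N + \<epsilon>)))) (coset g (N + \<epsilon>))"
    unfolding prod.case
    by (intro has_sum_cmult_right has_sum_diff theta_null_has_sum theta_null_hessian_has_sum) 
qed

text \<open>Symmetrising in the two summation variables turns the weight into
  \<open>(a \<cdot> (U - V)) (b \<cdot> (U - V)) / 2 = 2 (a \<cdot> d) (b \<cdot> d)\<close>, which depends on \<open>d\<close> only.\<close>

lemma theta_mixed_log_derivative:
  assumes \<epsilon>: "\<epsilon> \<in> lattice g"
  shows "((\<lambda>N. 2 * (exp (of_real (2 * pi) * \<i> * linear_form g y N) * (gaussian (1/2) N * theta_null_hessian a b (N + \<epsilon>))))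
     has_sum theta_series \<epsilon> (\<lambda>_. 1) y * theta_series \<epsilon> (\<lambda>U. linear_form g a U * linear_form g b U) y
       - theta_series \<epsilon> (linear_form g a) y * theta_series \<epsilon> (linear_form g b) y) (lattice g)"
proof (rule has_sum_SigmaD)
  let ?a = "linear_form g a" and ?b = "linear_form g b"
    and ?e = "\<lambda>N. exp (of_real (2 * pi) * \<i> * linear_form g y N)"
  let ?ab = "\<lambda>U. ?a U * ?b U"
  define S1 S2 where "S1 = theta_series \<epsilon> (\<lambda>_. 1) y * theta_series \<epsilon> ?ab y"
    and "S2 = theta_series \<epsilon> ?a y * theta_series \<epsilon> ?b y"
  have m: "moderate_growth g ?a" "moderate_growth g ?b" "moderate_growth g ?ab"
    by (intro moderate_growth_mult moderate_growth_linear_form)+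
  have "((\<lambda>x. 1/2 * ((case x of (N, d) \<Rightarrow> 1 * ?ab (N - d) * (?e N * (gaussian (1/2) N * gaussian (1/2) d)))
     + (case x of (N, d) \<Rightarrow> ?ab (N + d) * 1 * (?e N * (gaussian (1/2) N * gaussian (1/2) d)))
     - ((case x of (N, d) \<Rightarrow> ?a (N + d) * ?b (N - d) * (?e N * (gaussian (1/2) N * gaussian (1/2) d)))
     + (case x of (N, d) \<Rightarrow> ?b (N + d) * ?a (N - d) * (?e N * (gaussian (1/2) N * gaussian (1/2) d))))))
     has_sum 1/2 * (S1 + theta_series \<epsilon> ?ab y * theta_series \<epsilon> (\<lambda>_. 1) y
       - (S2 + theta_series \<epsilon> ?b y * theta_series \<epsilon> ?a y))) (Sigma (lattice g) (\<lambda>N. coset g (N + \<epsilon>)))"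
    unfolding S1_def S2_def
    by (intro has_sum_cmult_right has_sum_add has_sum_diff theta_series_product m moderate_growth_const \<epsilon>)
  also have "1/2 * (S1 + theta_series \<epsilon> ?ab y * theta_series \<epsilon> (\<lambda>_. 1) y
       - (S2 + theta_series \<epsilon> ?b y * theta_series \<epsilon> ?a y)) = S1 - S2"
    by (simp add: S1_def S2_def)
  finally show "((\<lambda>(N, d). 2 * (?e N * (gaussian (1/2) N * (?ab d * gaussian (1/2) d))))
     has_sum S1 - S2) (Sigma (lattice g) (\<lambda>N. coset g (N + \<epsilon>)))"
    by (rule has_sum_cong[THEN iffD1, rotated])
       (use coset_subset in \<open>auto simp: linear_form_add linear_form_diff field_simps subset_iff\<close>)
next
  fix N
  show "((\<lambda>d. case (N, d) of (N, d) \<Rightarrow> 2 * (exp (of_real (2 * pi) * \<i> * linear_form g y N) * (gaussian (1/2) N *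
        (linear_form g a d * linear_form g b d * gaussian (1/2) d))))
    has_sum 2 * (exp (of_real (2 * pi) * \<i> * linear_form g y N) * (gaussian (1/2) N * theta_null_hessian a b (N + \<epsilon>)))) (coset g (N + \<epsilon>))"
    unfolding prod.case by (intro has_sum_cmult_right theta_null_hessian_has_sum)
qed

end

section \<open>Vanishing products of gradients\<close>

lemma has_sum_sum:
  fixes f :: "'b \<Rightarrow> 'a \<Rightarrow> complex"
  assumes "\<And>x. x \<in> D \<Longrightarrow> (f x has_sum s x) A"
  shows "((\<lambda>u. \<Sum>x\<in>D. f x u) has_sum (\<Sum>x\<in>D. s x)) A"
  using assms by (induction D rule: infinite_finite_induct) (auto intro: has_sum_add)

definition half :: "int vec \<Rightarrow> nat \<Rightarrow> complex" where
  "half \<delta> i = of_int (\<delta> $ i) / 2"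

context siegel_point
begin

lemma theta_series_has_sum:
  "moderate_growth g p \<Longrightarrow> ((\<lambda>U. p U * theta_term y U) has_sum theta_series \<epsilon> p y) (coset g \<epsilon>)"
  unfolding theta_series_def
  by (intro has_sum_infsum rapidly_decreasing_summable[where g = g] weighted_term_rapidly_decreasing)

text \<open>For an even characteristic the theta series is an even function: the substitution \<open>U \<mapsto> - U\<close>
  preserves the class of \<open>\<epsilon>\<close> and reverses the sign of every term of the gradient.\<close>

lemma theta_gradient_even:
  assumes "even (\<Sum>i<g. \<delta> $ i * \<epsilon> $ i)"
  shows "theta_series \<epsilon> (linear_form g a) (half \<delta>) = 0"
proof -
  let ?f = "\<lambda>U. linear_form g a U * theta_term (half \<delta>) U"
  have odd: "?f (- U) = - ?f U" if U: "U \<in> coset g \<epsilon>" for U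
  proof -
    have Ul: "U \<in> lattice g" using U coset_subset by blast
    have "even (\<Sum>i<g. \<delta> $ i * (U $ i - \<epsilon> $ i))"
      using U by (intro dvd_sum dvd_mult) (auto simp: coset_def)
    then have "even (\<Sum>i<g. \<delta> $ i * U $ i)"
      using assms by (simp add: algebra_simps sum_subtractf)
    then obtain m where m: "(\<Sum>i<g. \<delta> $ i * U $ i) = 2 * m" by (elim evenE)
    have "linear_form g (half \<delta>) U = of_int (\<Sum>i<g. \<delta> $ i * U $ i) / 2"
      by (simp add: linear_form_def half_def sum_divide_distrib)
    then have lin: "linear_form g (half \<delta>) U = of_int m" by (simp add: m)
    have "exp (of_real pi * \<i> * linear_form g (half \<delta>) (- U)) =
        exp (of_real pi * \<i> * of_int m) * exp (2 * of_real pi * \<i> * of_int (- m))"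
      using Ul by (simp add: linear_form_uminus lin algebra_simps flip: exp_add)
    also have "exp (2 * of_real pi * \<i> * of_int (- m)) = (1::complex)"
      unfolding exp_two_pi_i_eq_1_iff by simp
    finally show ?thesis
      using Ul by (simp add: theta_term_def gaussian_uminus linear_form_uminus lin)
  qed
  have mem: "- U \<in> coset g \<epsilon>" if "U \<in> coset g \<epsilon>" for U
    using that by (auto simp: coset_def)
  have "theta_series \<epsilon> (linear_form g a) (half \<delta>) = infsum (\<lambda>U. - ?f U) (coset g \<epsilon>)"
    unfolding theta_series_def
    by (rule infsum_reindex_bij_witness[of _ uminus uminus]) (use mem odd in auto)
  also have "\<dots> = - theta_series \<epsilon> (linear_form g a) (half \<delta>)"
    by (simp add: theta_series_def infsum_uminus)
  finally show ?thesis by simp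
qed

text \<open>By \<open>theta_gradient_product\<close> the hypothesis says that all Fourier coefficients in \<open>\<delta>\<close> of
  \<open>N \<mapsto> T(N + \<epsilon>) \<cdot> (a \<cdot> N) (b \<cdot> N) - W(N + \<epsilon>)\<close>, weighted by the Gaussian, vanish.
  Summing over \<open>\<delta>\<close> against the character of \<open>\<sigma>\<close> isolates the vectors \<open>N\<close> in the class of \<open>\<sigma>\<close>.
  On that class \<open>T(N + \<epsilon>)\<close> and \<open>W(N + \<epsilon>)\<close> are constant, and \<open>\<epsilon>\<close> is chosen so that \<open>\<sigma> + \<epsilon>\<close> is in the class of \<open>\<sigma>'\<close>.\<close>

lemma theta_nulls_proportional:
  assumes vanish: "\<And>\<epsilon> \<delta>. \<epsilon> \<in> binary_vecs g \<Longrightarrow> \<delta> \<in> binary_vecs g \<Longrightarrow>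
      theta_series \<epsilon> (linear_form g a) (half \<delta>) * theta_series \<epsilon> (linear_form g b) (half \<delta>) = 0"
    and \<sigma>: "\<sigma> \<in> lattice g" "\<sigma>' \<in> lattice g"
  shows "theta_null \<sigma> * theta_null_hessian a b \<sigma>' = theta_null_hessian a b \<sigma> * theta_null \<sigma>'"
proof -
  define \<epsilon> where "\<epsilon> = vec g (\<lambda>i. (\<sigma>' $ i - \<sigma> $ i) mod 2)"
  have \<epsilon>: "\<epsilon> \<in> lattice g" "\<epsilon> \<in> binary_vecs g"
    by (auto simp: \<epsilon>_def binary_vecs_def)
  have shift: "coset g (N + \<epsilon>) = coset g \<sigma>'" if "N \<in> coset g \<sigma>" for N
  proof -
    have "even (\<sigma> $ i + \<epsilon> $ i - \<sigma>' $ i)" if "i < g" for i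
      using that unfolding \<epsilon>_def by simp presburger
    then have "coset g (\<sigma> + \<epsilon>) = coset g \<sigma>'" using \<epsilon> by (intro coset_cong) auto
    then show ?thesis using coset_eq[OF \<epsilon>(1) \<sigma>(1) that] by simp
  qed
  define h where "h = (\<lambda>N. gaussian (1/2) N *
      (linear_form g a N * linear_form g b N * theta_null (N + \<epsilon>) - theta_null_hessian a b (N + \<epsilon>)))"
  define e where "e = (\<lambda>\<delta> N. exp (of_real (2 * pi) * \<i> * linear_form g (half \<delta>) N))"
  have "((\<lambda>N. e \<delta> (- \<sigma>) * (e \<delta> N * h N)) has_sum e \<delta> (- \<sigma>) * 0) (lattice g)" if "\<delta> \<in> cube g 2" for \<delta>
    using theta_gradient_product[OF \<epsilon>(1), of "half \<delta>" a b] vanish[OF \<epsilon>(2)] that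
    unfolding h_def e_def cube_2_eq_binary_vecs by (intro has_sum_cmult_right) simp
  then have "((\<lambda>N. \<Sum>\<delta>\<in>cube g 2. e \<delta> (- \<sigma>) * (e \<delta> N * h N)) has_sum (\<Sum>\<delta>\<in>cube g 2. e \<delta> (- \<sigma>) * 0)) (lattice g)"
    by (rule has_sum_sum)
  also have "?this \<longleftrightarrow> ((\<lambda>N. 2 ^ g * h N) has_sum 0) (coset g \<sigma>)"
  proof -
    have sum: "(\<Sum>\<delta>\<in>cube g 2. e \<delta> (- \<sigma>) * (e \<delta> N * h N)) = (if N \<in> coset g \<sigma> then 2 ^ g else 0) * h N"
      if N: "N \<in> lattice g" for N
    proof -
      have "e \<delta> (- \<sigma>) * e \<delta> N = exp (2 * of_real pi * \<i> * (\<Sum>i<g. of_int ((N - \<sigma>) $ i) * of_int (\<delta> $ i) / of_nat 2))" for \<delta>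
      proof -
        have "linear_form g (half \<delta>) (- \<sigma>) + linear_form g (half \<delta>) N =
            (\<Sum>i<g. of_int ((N - \<sigma>) $ i) * of_int (\<delta> $ i) / of_nat 2)"
          unfolding linear_form_def sum.distrib[symmetric] using N \<sigma>
          by (intro sum.cong) (auto simp: half_def field_simps)
        then show ?thesis
          unfolding e_def by (simp flip: exp_add distrib_left)
      qed
      then have "(\<Sum>\<delta>\<in>cube g 2. e \<delta> (- \<sigma>) * (e \<delta> N * h N)) =
          (\<Sum>\<delta>\<in>cube g 2. exp (2 * of_real pi * \<i> * (\<Sum>i<g. of_int ((N - \<sigma>) $ i) * of_int (\<delta> $ i) / of_nat 2))) * h N"
        by (simp add: sum_distrib_right flip: mult.assoc)
      also have "\<dots> = (if N \<in> coset g \<sigma> then 2 ^ g else 0) * h N"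
        using N \<sigma> by (subst sum_cube_characters) (auto simp: coset_def)
      finally show ?thesis .
    qed
    show ?thesis
      by (rule has_sum_cong_neutral[of "coset g \<sigma>" "lattice g", THEN trans])
         (use sum coset_subset in \<open>auto simp: subset_iff\<close>)
  qed
  finally have zero: "((\<lambda>N. 2 ^ g * h N) has_sum 0) (coset g \<sigma>)" .
  have "((\<lambda>N. 2 ^ g * (linear_form g a N * linear_form g b N * gaussian (1/2) N * theta_null \<sigma>'
      - gaussian (1/2) N * theta_null_hessian a b \<sigma>')) has_sum
      2 ^ g * (theta_null_hessian a b \<sigma> * theta_null \<sigma>' - theta_null \<sigma> * theta_null_hessian a b \<sigma>')) (coset g \<sigma>)"
    by (intro has_sum_cmult_right has_sum_cmult_left has_sum_diff theta_null_has_sum theta_null_hessian_has_sum)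
  also have "?this \<longleftrightarrow> ((\<lambda>N. 2 ^ g * h N) has_sum
      2 ^ g * (theta_null_hessian a b \<sigma> * theta_null \<sigma>' - theta_null \<sigma> * theta_null_hessian a b \<sigma>')) (coset g \<sigma>)"
    by (intro has_sum_cong) (simp add: h_def theta_null_def theta_null_hessian_def shift algebra_simps)
  finally show ?thesis
    using has_sum_unique[OF zero] by fastforce
qed

abbreviation theta :: "(nat \<Rightarrow> complex) \<Rightarrow> complex" where
  "theta \<equiv> theta_series (0\<^sub>v g) (\<lambda>_. 1)"

text \<open>The term of \<open>\<theta>\<close> at \<open>U = 0\<close> is 1. Averaging \<open>\<theta>\<close> over the points \<open>2\<delta>/n\<close> leaves the terms whose
  index \<open>U\<close> is divisible by \<open>n\<close>; for large \<open>n\<close> all of these except the one at \<open>0\<close> lie in the tail of an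
  absolutely convergent series, so that the average is nonzero.\<close>

lemma theta_not_identically_zero: "\<exists>y. theta y \<noteq> 0"
proof (rule ccontr)
  assume "\<nexists>y. theta y \<noteq> 0"
  then have zero: "theta y = 0" for y by blast
  let ?L = "coset g (0\<^sub>v g)" and ?G = "gaussian (1/4)"
  have G: "(\<lambda>U. norm (?G U)) summable_on lattice g"
    by (intro rapidly_decreasing_abs_summable[where g = g] gaussian_rapidly_decreasing) simp
  obtain F where F: "finite F" "F \<subseteq> lattice g"
    "dist (\<Sum>U\<in>F. norm (?G U)) (\<Sum>\<^sub>\<infinity>U\<in>lattice g. norm (?G U)) \<le> 1/2"
    using infsum_finite_approximation[OF G, of "1/2"] by auto
  have tail: "(\<Sum>\<^sub>\<infinity>U\<in>lattice g - F. norm (?G U)) \<le> 1/2"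
  proof -
    have "(\<Sum>\<^sub>\<infinity>U\<in>lattice g - F. norm (?G U)) = (\<Sum>\<^sub>\<infinity>U\<in>lattice g. norm (?G U)) - (\<Sum>U\<in>F. norm (?G U))"
      using F(1,2) by (subst infsum_Diff[OF G]) auto
    then show ?thesis using F(3) unfolding dist_real_def by linarith
  qed
  \<comment> \<open>\<open>n\<close> exceeds every coordinate of every vector in \<open>F\<close>, so that \<open>F\<close> contains no nonzero vector divisible by \<open>n\<close>.\<close>
  define n where "n = Suc (\<Sum>U\<in>F. \<Sum>i<g. nat \<bar>U $ i\<bar>)"
  have n: "n > 0" by (simp add: n_def)
  define D where "D = {U \<in> ?L. \<forall>i<g. int n dvd U $ i}"
  have D_sub: "D - {0\<^sub>v g} \<subseteq> lattice g - F"
  proof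
    fix U assume U: "U \<in> D - {0\<^sub>v g}"
    then have Ul: "U \<in> lattice g" using coset_subset by (auto simp: D_def)
    have "U \<notin> F"
    proof
      assume "U \<in> F"
      obtain i where i: "i < g" "U $ i \<noteq> 0" using U Ul by (auto simp: vec_eq_iff)
      have "nat \<bar>U $ i\<bar> \<le> (\<Sum>i<g. nat \<bar>U $ i\<bar>)"
        using i by (intro member_le_sum) auto
      also have "\<dots> \<le> (\<Sum>U\<in>F. \<Sum>i<g. nat \<bar>U $ i\<bar>)"
        using \<open>U \<in> F\<close> F(1) by (intro member_le_sum[of U F "\<lambda>U. \<Sum>i<g. nat \<bar>U $ i\<bar>"]) auto
      finally have "nat \<bar>U $ i\<bar> < n" unfolding n_def by (rule le_imp_less_Suc)
      then have "\<bar>U $ i\<bar> < int n" by linarith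
      moreover have "int n dvd U $ i" using U i by (auto simp: D_def)
      ultimately show False using i(2) zdvd_not_zless[of "\<bar>U $ i\<bar>" "int n"] by simp
    qed
    then show "U \<in> lattice g - F" using Ul by blast
  qed
  have "((\<lambda>U. \<Sum>\<delta>\<in>cube g n. 1 * theta_term (\<lambda>i. 2 * (of_int (\<delta> $ i) / of_nat n)) U) has_sum (\<Sum>\<delta>\<in>cube g n. 0)) ?L"
  proof (rule has_sum_sum)
    fix \<delta>
    show "((\<lambda>U. 1 * theta_term (\<lambda>i. 2 * (of_int (\<delta> $ i) / of_nat n)) U) has_sum 0) ?L"
      using theta_series_has_sum[OF moderate_growth_const[of g 1], where \<epsilon> = "0\<^sub>v g"
        and y = "\<lambda>i. 2 * (of_int (\<delta> $ i) / of_nat n)"] unfolding zero .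
  qed
  also have "?this \<longleftrightarrow> ((\<lambda>U. of_nat n ^ g * ?G U) has_sum 0) D"
  proof -
    have sum: "(\<Sum>\<delta>\<in>cube g n. 1 * theta_term (\<lambda>i. 2 * (of_int (\<delta> $ i) / of_nat n)) U) =
        (if U \<in> D then of_nat n ^ g else 0) * ?G U" if "U \<in> ?L" for U
    proof -
      have "theta_term (\<lambda>i. 2 * (of_int (\<delta> $ i) / of_nat n)) U =
          exp (2 * of_real pi * \<i> * (\<Sum>i<g. of_int (U $ i) * of_int (\<delta> $ i) / of_nat n)) * ?G U" for \<delta>
        unfolding theta_term_def linear_form_scale by (simp add: linear_form_def mult_ac)
      then show ?thesis
        using that n by (simp add: sum_cube_characters D_def flip: sum_distrib_right)
    qed
    have "D \<subseteq> ?L" by (auto simp: D_def)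
    then show ?thesis
      by (intro has_sum_cong_neutral[of D ?L, THEN trans]) (use sum in \<open>auto simp: subset_iff\<close>)
  qed
  finally have "((\<lambda>U. of_nat n ^ g * ?G U) has_sum 0) D" .
  from has_sum_cmult_right[OF this, of "inverse (of_nat n ^ g)"]
  have D0: "(?G has_sum 0) D" using n by (simp flip: mult.assoc)
  have mem0: "0\<^sub>v g \<in> D" by (auto simp: D_def coset_def)
  have "(?G has_sum (0 - ?G (0\<^sub>v g))) (D - {0\<^sub>v g})"
    by (intro has_sum_Diff[OF D0] has_sum_finiteI) (use mem0 in auto)
  moreover have "?G (0\<^sub>v g) = 1" by (simp add: gaussian_def bilinear_def)
  ultimately have minus1: "infsum ?G (D - {0\<^sub>v g}) = - 1" by (simp add: infsumI)
  have sums: "(\<lambda>U. norm (?G U)) summable_on lattice g - F"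
    by (rule summable_on_subset_banach[OF G]) blast
  have sumsD: "(\<lambda>U. norm (?G U)) summable_on D - {0\<^sub>v g}"
    by (rule summable_on_subset_banach[OF sums D_sub])
  have "1 \<le> (\<Sum>\<^sub>\<infinity>U\<in>D - {0\<^sub>v g}. norm (?G U))"
    using norm_infsum_bound[OF sumsD] by (simp add: minus1)
  also have "\<dots> \<le> (\<Sum>\<^sub>\<infinity>U\<in>lattice g - F. norm (?G U))"
    by (intro infsum_mono2 sums sumsD D_sub) auto
  finally show False using tail by simp
qed

text \<open>The second order theta constants cannot all vanish, since \<open>\<theta>\<^sup>2\<close> is a series with these coefficients.\<close>

lemma theta_null_hessian_proportional:
  assumes vanish: "\<And>\<epsilon> \<delta>. \<epsilon> \<in> binary_vecs g \<Longrightarrow> \<delta> \<in> binary_vecs g \<Longrightarrow>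
      theta_series \<epsilon> (linear_form g a) (half \<delta>) * theta_series \<epsilon> (linear_form g b) (half \<delta>) = 0"
  obtains K where "\<And>\<sigma>. \<sigma> \<in> lattice g \<Longrightarrow> theta_null_hessian a b \<sigma> = K * theta_null \<sigma>"
proof -
  obtain \<sigma>\<^sub>0 where \<sigma>\<^sub>0: "\<sigma>\<^sub>0 \<in> lattice g" "theta_null \<sigma>\<^sub>0 \<noteq> 0"
  proof (cases "\<exists>\<sigma>\<in>lattice g. theta_null \<sigma> \<noteq> 0")
    case True
    then show ?thesis using that by blast
  next
    case False
    then have z: "theta_null \<sigma> = 0" if "\<sigma> \<in> lattice g" for \<sigma> using that by blast
    obtain y where y: "theta y \<noteq> 0" using theta_not_identically_zero by blast
    have "((\<lambda>N. 0) has_sum (theta y)\<^sup>2) (lattice g)"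
      using theta_square[of "0\<^sub>v g" y] by (rule has_sum_cong[THEN iffD1, rotated]) (auto simp: z)
    then have "(theta y)\<^sup>2 = 0" using has_sum_unique[OF _ has_sum_0_simp] by blast
    then show ?thesis using y by simp
  qed
  show thesis
  proof (rule that[of "theta_null_hessian a b \<sigma>\<^sub>0 / theta_null \<sigma>\<^sub>0"])
    show "theta_null_hessian a b \<sigma> = theta_null_hessian a b \<sigma>\<^sub>0 / theta_null \<sigma>\<^sub>0 * theta_null \<sigma>" if "\<sigma> \<in> lattice g" for \<sigma>
      using theta_nulls_proportional[OF vanish \<sigma>\<^sub>0(1) that] \<sigma>\<^sub>0(2) by (simp add: field_simps)
  qed
qed

lemma theta_series_has_field_derivative:
  assumes p: "moderate_growth g p"
  shows "((\<lambda>s. theta_series \<epsilon> p (\<lambda>i. y i + s * a i)) has_field_derivative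
     of_real pi * \<i> * theta_series \<epsilon> (\<lambda>U. linear_form g a U * p U) (\<lambda>i. y i + s * a i)) (at s)"
proof -
  let ?C = "coset g \<epsilon>"
  define c where "c = (\<lambda>U. p U * theta_term y U)"
  define \<alpha> where "\<alpha> = (\<lambda>U. of_real pi * \<i> * linear_form g a U)"
  have sum: "(\<lambda>U. norm (c U) * exp (r * norm (\<alpha> U))) summable_on ?C" for r
  proof (rule summable_on_comparison_test)
    show "(\<lambda>U. norm (c U) * exp ((\<bar>r\<bar> * (pi * (\<Sum>i<g. norm (a i)))) * norm1 g U)) summable_on ?C"
      using weighted_term_rapidly_decreasing[OF p] unfolding c_def rapidly_decreasing_def by blast
    fix U
    have "r * norm (\<alpha> U) \<le> \<bar>r\<bar> * norm (\<alpha> U)" by (intro mult_right_mono) auto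
    also have "\<dots> \<le> \<bar>r\<bar> * (pi * ((\<Sum>i<g. norm (a i)) * norm1 g U))"
      unfolding \<alpha>_def by (intro mult_left_mono) (auto simp: norm_mult norm_linear_form_le)
    finally show "norm (c U) * exp (r * norm (\<alpha> U)) \<le> norm (c U) * exp ((\<bar>r\<bar> * (pi * (\<Sum>i<g. norm (a i)))) * norm1 g U)"
      by (simp add: mult_left_mono mult.assoc)
  qed simp
  have term_eq: "theta_term (\<lambda>i. y i + s * a i) U = theta_term y U * exp (\<alpha> U * s)" for s U
    by (simp add: theta_term_def \<alpha>_def linear_form_add_coeff linear_form_scale exp_add[symmetric] algebra_simps)
  have eq1: "theta_series \<epsilon> p (\<lambda>i. y i + s * a i) = (\<Sum>\<^sub>\<infinity>U\<in>?C. c U * exp (\<alpha> U * s))" for s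
    by (simp add: theta_series_def term_eq c_def mult.assoc)
  have "of_real pi * \<i> * theta_series \<epsilon> (\<lambda>U. linear_form g a U * p U) (\<lambda>i. y i + s * a i) =
      (\<Sum>\<^sub>\<infinity>U\<in>?C. of_real pi * \<i> * (linear_form g a U * p U * theta_term (\<lambda>i. y i + s * a i) U))"
    unfolding theta_series_def by (rule infsum_cmult_right'[symmetric])
  also have "\<dots> = (\<Sum>\<^sub>\<infinity>U\<in>?C. c U * \<alpha> U * exp (\<alpha> U * s))"
    by (simp add: term_eq c_def \<alpha>_def mult_ac)
  finally show ?thesis
    unfolding eq1 using exponential_sum_has_field_derivative[OF sum] by simp
qed

text \<open>The proportionality makes \<open>\<theta> \<cdot> \<partial>\<^sub>a\<partial>\<^sub>b\<theta> - \<partial>\<^sub>a\<theta> \<cdot> \<partial>\<^sub>b\<theta>\<close> a constant multiple of \<open>\<theta>\<^sup>2\<close>, that is, the mixed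
  derivative of \<open>log \<theta>\<close> in the directions \<open>a\<close> and \<open>b\<close> is constant.\<close>

lemma theta_exponential_splitting:
  assumes proportional: "\<And>\<sigma>. \<sigma> \<in> lattice g \<Longrightarrow> theta_null_hessian a b \<sigma> = K * theta_null \<sigma>"
    and nz: "theta y \<noteq> 0"
  shows "theta (\<lambda>i. y i + s * a i + t * b i) * theta y =
    exp (- (2 * (of_real pi)\<^sup>2 * K) * s * t) * theta (\<lambda>i. y i + s * a i) * theta (\<lambda>i. y i + t * b i)"
proof -
  let ?a = "linear_form g a" and ?b = "linear_form g b"
  define f where "f = (\<lambda>p s t. theta_series (0\<^sub>v g) p (\<lambda>i. y i + s * a i + t * b i))"
  have d1: "((\<lambda>s. f p s t) has_field_derivative of_real pi * \<i> * f (\<lambda>U. ?a U * p U) s t) (at s)"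
    if "moderate_growth g p" for p s t
    using theta_series_has_field_derivative[OF that, of "0\<^sub>v g" "\<lambda>i. y i + t * b i" a s]
    by (simp add: f_def algebra_simps)
  have d2: "((\<lambda>t. f p s t) has_field_derivative of_real pi * \<i> * f (\<lambda>U. ?b U * p U) s t) (at t)"
    if "moderate_growth g p" for p s t
    using theta_series_has_field_derivative[OF that, of "0\<^sub>v g" "\<lambda>i. y i + s * a i" b t]
    by (simp add: f_def)
  have ma: "moderate_growth g (\<lambda>U. ?a U * 1)"
    by (intro moderate_growth_mult moderate_growth_linear_form moderate_growth_const)
  have d12: "((\<lambda>t. of_real pi * \<i> * f (\<lambda>U. ?a U * 1) s t) has_field_derivative
      of_real pi * \<i> * (of_real pi * \<i> * f (\<lambda>U. ?b U * (?a U * 1)) s t)) (at t)" for s t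
    using d2[OF ma] by (rule DERIV_cmult)
  have rel: "f (\<lambda>_. 1) s t * (of_real pi * \<i> * (of_real pi * \<i> * f (\<lambda>U. ?b U * (?a U * 1)) s t)) -
      (of_real pi * \<i> * f (\<lambda>U. ?a U * 1) s t) * (of_real pi * \<i> * f (\<lambda>U. ?b U * 1) s t) =
      - (2 * (of_real pi)\<^sup>2 * K) * (f (\<lambda>_. 1) s t)\<^sup>2" for s t
  proof -
    define z where "z = (\<lambda>i. y i + s * a i + t * b i)"
    have "((\<lambda>N. (2 * K) * (exp (of_real (2 * pi) * \<i> * linear_form g z N) * (gaussian (1/2) N * theta_null (N + 0\<^sub>v g))))
        has_sum (2 * K) * (theta z)\<^sup>2) (lattice g)"
      by (intro has_sum_cmult_right theta_square) simp
    then have "((\<lambda>N. 2 * (exp (of_real (2 * pi) * \<i> * linear_form g z N) * (gaussian (1/2) N * theta_null_hessian a b (N + 0\<^sub>v g))))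
        has_sum (2 * K) * (theta z)\<^sup>2) (lattice g)"
      by (rule has_sum_cong[THEN iffD1, rotated]) (simp add: proportional)
    then have *: "theta z * theta_series (0\<^sub>v g) (\<lambda>U. ?a U * ?b U) z -
        theta_series (0\<^sub>v g) ?a z * theta_series (0\<^sub>v g) ?b z = 2 * K * (theta z)\<^sup>2"
      using has_sum_unique[OF theta_mixed_log_derivative[of "0\<^sub>v g" z a b]] by simp
    have square: "of_real pi * \<i> * (of_real pi * \<i>) = - (of_real pi :: complex)\<^sup>2"
      by (simp add: power_mult_distrib flip: power2_eq_square)
    have "theta z * (c * (c * X)) - (c * Y) * (c * Z) = (c * c) * (theta z * X - Y * Z)" for c X Y Z
      by (simp add: algebra_simps)
    from this[of "of_real pi * \<i>", unfolded square]
    have "theta z * (of_real pi * \<i> * (of_real pi * \<i> * theta_series (0\<^sub>v g) (\<lambda>U. ?a U * ?b U) z)) -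
       (of_real pi * \<i> * theta_series (0\<^sub>v g) ?a z) * (of_real pi * \<i> * theta_series (0\<^sub>v g) ?b z) =
       - (of_real pi)\<^sup>2 * (theta z * theta_series (0\<^sub>v g) (\<lambda>U. ?a U * ?b U) z -
        theta_series (0\<^sub>v g) ?a z * theta_series (0\<^sub>v g) ?b z)" .
    then show ?thesis unfolding * by (simp add: f_def mult.commute[of "?b _"] flip: z_def)
  qed
  have "f (\<lambda>_. 1) 0 0 \<noteq> 0" using nz by (simp add: f_def)
  from constant_mixed_logarithmic_derivative[OF d1[OF moderate_growth_const] d2[OF moderate_growth_const] d12 rel this, of s t]
  show ?thesis by (simp add: f_def)
qed

definition unit_coeff :: "nat \<Rightarrow> nat \<Rightarrow> complex" where
  "unit_coeff i j = (if j = i then 1 else 0)"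

lemma linear_form_unit_coeff: "i < g \<Longrightarrow> linear_form g (unit_coeff i) U = of_int (U $ i)"
  by (simp add: linear_form_def unit_coeff_def if_distrib[of "\<lambda>x. x * _"] cong: if_cong)

lemma theta_periodic:
  assumes "i < g"
  shows "theta (\<lambda>j. y j + unit_coeff i j) = theta y"
  unfolding theta_series_def
proof (intro infsum_cong arg_cong2[of _ _ _ _ "(*)"] refl)
  fix U assume "U \<in> coset g (0\<^sub>v g)"
  then obtain m where "U $ i = 2 * m" using assms by (auto simp: coset_def elim: evenE)
  then have "exp (of_real pi * \<i> * linear_form g (\<lambda>j. y j + unit_coeff i j) U) =
      exp (of_real pi * \<i> * linear_form g y U) * exp (2 * of_real pi * \<i> * of_int m)"
    using assms by (simp add: linear_form_add_coeff linear_form_unit_coeff algebra_simps flip: exp_add)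
  also have "exp (2 * of_real pi * \<i> * of_int m) = (1 :: complex)"
    unfolding exp_two_pi_i_eq_1_iff by simp
  finally show "theta_term (\<lambda>j. y j + unit_coeff i j) U = theta_term y U"
    by (simp add: theta_term_def)
qed

lemma theta_quasi_periodic:
  assumes i: "i < g"
  shows "theta (\<lambda>j. y j + \<tau> $$ (j, i)) = exp (- (of_real pi * \<i> * (\<tau> $$ (i, i) + 2 * y i))) * theta y"
proof -
  let ?L = "coset g (0\<^sub>v g)"
  define E where "E = (2 :: int) \<cdot>\<^sub>v unit_vec g i"
  have E: "E \<in> lattice g" by (simp add: E_def)
  have E_nth: "E $ j = (if j = i then 2 else 0)" if "j < g" for j
    using that i by (simp add: E_def)
  have linE: "linear_form g a E = 2 * a i" for a
    using i by (simp add: linear_form_def E_nth if_distrib[of "\<lambda>x. _ * x"] if_distrib[of of_int] cong: if_cong)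
  have bilE: "bilinear U E = 2 * linear_form g (\<lambda>j. \<tau> $$ (j, i)) U" for U
    using i by (simp add: bilinear_def linear_form_def E_nth if_distrib[of "\<lambda>x. _ * x"] if_distrib[of of_int]
        sum_distrib_left mult_ac cong: if_cong)
  have term_eq: "theta_term (\<lambda>j. y j + \<tau> $$ (j, i)) U =
      exp (- (of_real pi * \<i> * (\<tau> $$ (i, i) + 2 * y i))) * theta_term y (U + E)" if U: "U \<in> lattice g" for U
  proof -
    have bilinear: "bilinear (U + E) (U + E) = bilinear U U + 4 * linear_form g (\<lambda>j. \<tau> $$ (j, i)) U + 4 * \<tau> $$ (i, i)"
      using U E by (simp add: bilinear_add_left bilinear_add_right bilinear_commute[of E U] bilE linear_form_add linE)
    have lin: "linear_form g y (U + E) = linear_form g y U + 2 * y i"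
      using U E by (simp add: linear_form_add linE)
    show ?thesis
      unfolding theta_term_def gaussian_def bilinear lin linear_form_add_coeff exp_add[symmetric]
      by (rule arg_cong[of _ _ exp]) (simp add: algebra_simps)
  qed
  have "theta (\<lambda>j. y j + \<tau> $$ (j, i)) =
      (\<Sum>\<^sub>\<infinity>U\<in>?L. exp (- (of_real pi * \<i> * (\<tau> $$ (i, i) + 2 * y i))) * theta_term y (U + E))"
    unfolding theta_series_def using coset_subset by (intro infsum_cong) (simp add: term_eq subset_iff)
  also have "\<dots> = exp (- (of_real pi * \<i> * (\<tau> $$ (i, i) + 2 * y i))) * (\<Sum>\<^sub>\<infinity>U\<in>?L. theta_term y (U + E))"
    by (rule infsum_cmult_right')
  also have "(\<Sum>\<^sub>\<infinity>U\<in>?L. theta_term y (U + E)) = (\<Sum>\<^sub>\<infinity>U\<in>?L. theta_term y U)"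
    by (rule infsum_reindex_bij_witness[of _ "\<lambda>U. U - E" "\<lambda>U. U + E"])
       (use E in \<open>auto simp: coset_def E_nth intro!: eq_vecI\<close>)
  finally show ?thesis by (simp add: theta_series_def)
qed

text \<open>For a coordinate direction \<open>a = e\<^sub>i\<close> the splitting at \<open>s = 1\<close> compares \<open>\<theta>\<close> with its translate by a
  period, which leaves \<open>exp (K' t) = 1\<close> for all small \<open>t\<close>. General \<open>a\<close> follow by linearity.\<close>

lemma theta_null_hessian_zero:
  assumes vanish: "\<And>a b \<epsilon> \<delta>. (\<And>i. k \<le> i \<Longrightarrow> a i = 0) \<Longrightarrow> (\<And>i. i < k \<Longrightarrow> b i = 0) \<Longrightarrow>
      \<epsilon> \<in> binary_vecs g \<Longrightarrow> \<delta> \<in> binary_vecs g \<Longrightarrow>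
      theta_series \<epsilon> (linear_form g a) (half \<delta>) * theta_series \<epsilon> (linear_form g b) (half \<delta>) = 0"
    and a: "\<And>i. k \<le> i \<Longrightarrow> a i = 0" and b: "\<And>i. i < k \<Longrightarrow> b i = 0"
    and k: "k \<le> g" and \<sigma>: "\<sigma> \<in> lattice g"
  shows "theta_null_hessian a b \<sigma> = 0"
proof -
  obtain y where y: "theta y \<noteq> 0" using theta_not_identically_zero by blast
  have unit_coeff: "theta_null_hessian (unit_coeff i) b \<sigma> = 0" if i: "i < k" for i
  proof -
    have "theta_series \<epsilon> (linear_form g (unit_coeff i)) (half \<delta>) * theta_series \<epsilon> (linear_form g b) (half \<delta>) = 0"
      if "\<epsilon> \<in> binary_vecs g" "\<delta> \<in> binary_vecs g" for \<epsilon> \<delta>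
      by (rule vanish) (use that b i in \<open>auto simp: unit_coeff_def\<close>)
    then obtain K where K: "\<And>\<sigma>. \<sigma> \<in> lattice g \<Longrightarrow> theta_null_hessian (unit_coeff i) b \<sigma> = K * theta_null \<sigma>"
      using theta_null_hessian_proportional by blast
    define K' where "K' = - (2 * (of_real pi)\<^sup>2 * K)"
    have per: "theta (\<lambda>j. z j + 1 * unit_coeff i j) = theta z" for z
      using theta_periodic[of i z] i k by simp
    have d: "((\<lambda>t. theta (\<lambda>j. y j + t * b j)) has_field_derivative
        of_real pi * \<i> * theta_series (0\<^sub>v g) (\<lambda>U. linear_form g b U * 1) (\<lambda>i. y i + t * b i)) (at t)" for t
      by (rule theta_series_has_field_derivative[OF moderate_growth_const])
    obtain e where e: "e > 0" "\<And>t. norm t < e \<Longrightarrow> theta (\<lambda>j. y j + t * b j) \<noteq> 0"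
      using nonzero_near_0[OF d[of 0]] y by auto
    have loc: "exp (K' * t) = 1" if t: "norm t < e" for t
    proof -
      have "(\<lambda>j. y j + 1 * unit_coeff i j + t * b j) = (\<lambda>j. (y j + t * b j) + 1 * unit_coeff i j)" by auto
      then have "theta (\<lambda>j. y j + t * b j) * theta y = exp (K' * t) * theta y * theta (\<lambda>j. y j + t * b j)"
        using theta_exponential_splitting[OF K y, of 1 t] unfolding K'_def[symmetric]
        by (simp only: per mult_1_right)
      then show ?thesis using y e(2)[OF t] by simp
    qed
    have "exp (K' * t) = 1" for t
      by (rule entire_eq_if_locally_eq[OF _ _ e(1) loc, where u' = "\<lambda>t. K' * exp (K' * t)" and v' = "\<lambda>_. 0"])
         (auto intro!: derivative_eq_intros)
    note one = this
    have "K' = 0"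
    proof (rule ccontr)
      assume "K' \<noteq> 0"
      then have "exp (1 :: complex) = 1" using one[of "1 / K'"] by simp
      then show False by (simp add: exp_eq_1)
    qed
    then have "K = 0" by (simp add: K'_def)
    then show ?thesis using K \<sigma> by simp
  qed
  have "((\<lambda>d. \<Sum>i<g. a i * ((linear_form g (unit_coeff i) d * linear_form g b d) * gaussian (1/2) d)) has_sum
      (\<Sum>i<g. a i * theta_null_hessian (unit_coeff i) b \<sigma>)) (coset g \<sigma>)"
    by (intro has_sum_sum has_sum_cmult_right theta_null_hessian_has_sum)
  also have "(\<Sum>i<g. a i * theta_null_hessian (unit_coeff i) b \<sigma>) = 0"
  proof (rule sum.neutral, rule ballI)
    show "a i * theta_null_hessian (unit_coeff i) b \<sigma> = 0" for i
      by (cases "i < k") (simp_all add: unit_coeff a)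
  qed
  also have "((\<lambda>d. \<Sum>i<g. a i * ((linear_form g (unit_coeff i) d * linear_form g b d) * gaussian (1/2) d)) has_sum 0) (coset g \<sigma>) \<longleftrightarrow>
      ((\<lambda>d. (linear_form g a d * linear_form g b d) * gaussian (1/2) d) has_sum 0) (coset g \<sigma>)"
    by (intro has_sum_cong) (simp add: linear_form_unit_coeff sum_distrib_left linear_form_def[of g a] mult_ac)
  finally show ?thesis using has_sum_unique[OF theta_null_hessian_has_sum] by blast
qed

text \<open>\<open>\<theta>\<close> splits as a product \<open>A B\<close> of a function of the first \<open>k\<close> coordinates and a function of the
  others. Translation by the column \<open>\<tau> e\<^sub>m\<close> acts on \<open>B\<close> through the lower part of that column, with
  a factor that is constant for \<open>m < k\<close> and involves \<open>exp (- 2\<pi>\<i> b\<^sub>m)\<close> for \<open>m \<ge> k\<close>. Applying the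
  translations for \<open>i\<close> and \<open>j\<close> in both orders compares this factor at two points that differ by
  \<open>\<tau>\<^sub>j\<^sub>i\<close>.\<close>

lemma off_diagonal_integral:
  assumes vanish: "\<And>a b \<epsilon> \<delta>. (\<And>i. k \<le> i \<Longrightarrow> a i = 0) \<Longrightarrow> (\<And>i. i < k \<Longrightarrow> b i = 0) \<Longrightarrow>
      \<epsilon> \<in> binary_vecs g \<Longrightarrow> \<delta> \<in> binary_vecs g \<Longrightarrow>
      theta_series \<epsilon> (linear_form g a) (half \<delta>) * theta_series \<epsilon> (linear_form g b) (half \<delta>) = 0"
    and k: "k \<le> g" and i: "i < k" and j: "k \<le> j" "j < g"
  shows "\<tau> $$ (j, i) \<in> \<int>"
proof -
  obtain y where y: "theta y \<noteq> 0" using theta_not_identically_zero by blast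
  \<comment> \<open>The base point \<open>y\<close> only serves to keep \<open>\<theta>(y)\<close> away from zero.\<close>
  define F where "F = (\<lambda>a b. theta (\<lambda>l. y l + a l + b l))"
  have hessian_zero: "theta_null_hessian a b \<sigma> = 0"
    if "\<And>i. k \<le> i \<Longrightarrow> a i = 0" "\<And>i. i < k \<Longrightarrow> b i = 0" "\<sigma> \<in> lattice g" for a b \<sigma>
    using vanish that(1,2) k that(3) by (rule theta_null_hessian_zero)
  have split: "F a b * theta y = F a (\<lambda>_. 0) * F (\<lambda>_. 0) b"
    if "\<And>i. k \<le> i \<Longrightarrow> a i = 0" "\<And>i. i < k \<Longrightarrow> b i = 0" for a b
  proof -
    have "theta_null_hessian a b \<sigma> = 0 * theta_null \<sigma>" if "\<sigma> \<in> lattice g" for \<sigma>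
      using hessian_zero[OF \<open>\<And>i. k \<le> i \<Longrightarrow> a i = 0\<close> \<open>\<And>i. i < k \<Longrightarrow> b i = 0\<close> that] by simp
    from theta_exponential_splitting[OF this y, of 1 1] show ?thesis
      by (simp add: F_def)
  qed
  define lo hi where "lo = (\<lambda>(x :: nat \<Rightarrow> complex) l. if l < k then x l else 0)"
    and "hi = (\<lambda>(x :: nat \<Rightarrow> complex) l. if l < k then 0 else x l)"
  define col where "col = (\<lambda>m l. \<tau> $$ (l, m))"
  have quasi: "F (lo (col m)) (\<lambda>l. b l + hi (col m) l) =
      exp (- (of_real pi * \<i> * (\<tau> $$ (m, m) + 2 * (y m + b m)))) * F (\<lambda>_. 0) b" if "m < g" for m b
  proof -
    have "(\<lambda>l. y l + lo (col m) l + (b l + hi (col m) l)) = (\<lambda>l. (y l + b l) + \<tau> $$ (l, m))"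
      by (auto simp: lo_def hi_def col_def)
    then show ?thesis using theta_quasi_periodic[OF that, of "\<lambda>l. y l + b l"] by (simp add: F_def)
  qed
  define A B where "A = (\<lambda>m. F (lo (col m)) (\<lambda>_. 0))" and "B = F (\<lambda>_. 0)"
  define q where "q = (\<lambda>m. exp (- (of_real pi * \<i> * (\<tau> $$ (m, m) + 2 * y m))))"
  have step: "A m * B (\<lambda>l. b l + hi (col m) l) = q m * exp (- (2 * of_real pi * \<i> * b m)) * B b * theta y"
    if "m < g" "\<And>i. i < k \<Longrightarrow> b i = 0" for m b
  proof -
    have "A m * B (\<lambda>l. b l + hi (col m) l) = F (lo (col m)) (\<lambda>l. b l + hi (col m) l) * theta y"
      unfolding A_def B_def using that by (intro split[symmetric]) (auto simp: lo_def hi_def)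
    then show ?thesis
      unfolding quasi[OF that(1)] B_def q_def by (simp add: algebra_simps flip: exp_add)
  qed
  have B0: "B (\<lambda>_. 0) = theta y" by (simp add: B_def F_def)
  have q: "q m \<noteq> 0" for m by (simp add: q_def)
  have AB: "A m * B (hi (col m)) = q m * theta y * theta y" if "m < g" for m
    using step[OF that, of "\<lambda>_. 0"] by (simp add: B0)
  have ig: "i < g" using i k by simp
  let ?u = "hi (col i)" and ?v = "hi (col j)"
  \<comment> \<open>The two orders in which \<open>B\<close> is translated by the lower parts of the columns \<open>i\<close> and \<open>j\<close>.\<close>
  have 1: "A i * B (\<lambda>l. ?v l + ?u l) = q i * B ?v * theta y"
    using step[OF ig, of ?v] i by (simp add: hi_def)
  have "(\<lambda>l. ?u l + ?v l) = (\<lambda>l. ?v l + ?u l)" by auto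
  then have 2: "A j * B (\<lambda>l. ?v l + ?u l) = q j * exp (- (2 * of_real pi * \<i> * \<tau> $$ (j, i))) * B ?u * theta y"
    using step[OF j(2), of ?u] j by (simp add: hi_def col_def)
  have "A j * (q i * B ?v * theta y) =
      A i * (q j * exp (- (2 * of_real pi * \<i> * \<tau> $$ (j, i))) * B ?u * theta y)"
    unfolding 1[symmetric] 2[symmetric] by (rule mult.left_commute)
  then have "q i * theta y * (A j * B ?v) = q j * exp (- (2 * of_real pi * \<i> * \<tau> $$ (j, i))) * theta y * (A i * B ?u)"
    by (simp only: mult_ac)
  then have "exp (- (2 * of_real pi * \<i> * \<tau> $$ (j, i))) = 1"
    unfolding AB[OF ig] AB[OF j(2)] using q y by simp
  then have "exp (2 * of_real pi * \<i> * \<tau> $$ (j, i)) = 1" by (simp add: exp_minus)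
  then show ?thesis unfolding exp_two_pi_i_eq_1_iff .
qed

end

section \<open>Characteristics and reducibility\<close>

context siegel_point
begin

lemma theta_series_cong:
  assumes "\<And>i. i < g \<Longrightarrow> y i = y' i"
  shows "theta_series \<epsilon> p y = theta_series \<epsilon> p y'"
proof -
  have "linear_form g y = linear_form g y'"
    using assms by (auto simp: linear_form_def fun_eq_iff)
  then show ?thesis by (simp add: theta_series_def theta_term_def)
qed

lemma theta_char_eq_theta_series:
  assumes \<epsilon>: "\<epsilon> \<in> lattice g" and \<delta>: "\<delta> \<in> lattice g" and z: "z \<in> carrier_vec g"
  shows "theta_char \<epsilon> \<delta> \<tau> z = theta_series \<epsilon> (\<lambda>_. 1) (\<lambda>i. z $ i + half \<delta> i)"
  unfolding theta_char_def theta_series_def Let_def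
proof (rule infsum_reindex_bij_witness[where j = "\<lambda>m. 2 \<cdot>\<^sub>v m + \<epsilon>" and i = "\<lambda>U. vec g (\<lambda>i. (U $ i - \<epsilon> $ i) div 2)"])
  have dim: "dim_row \<tau> = g" "dim_col \<tau> = g" using siegel_carrier[OF siegel] by auto
  fix m :: "int vec" assume "m \<in> carrier_vec (dim_vec \<epsilon>)"
  then have m: "m \<in> lattice g" using \<epsilon> by simp
  show "vec g (\<lambda>i. ((2 \<cdot>\<^sub>v m + \<epsilon>) $ i - \<epsilon> $ i) div 2) = m" "2 \<cdot>\<^sub>v m + \<epsilon> \<in> coset g \<epsilon>"
    using m \<epsilon> by (auto simp: coset_def)
  define U where "U = 2 \<cdot>\<^sub>v m + \<epsilon>"
  define u where "u = map_vec complex_of_int m + (1/2) \<cdot>\<^sub>v map_vec complex_of_int \<epsilon>"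
  have u: "u \<in> carrier_vec g" "u $ i = of_int (U $ i) / 2" if "i < g" for i
    using m \<epsilon> that by (auto simp: u_def U_def field_simps)
  have uc: "u \<in> carrier_vec g" using m \<epsilon> by (simp add: u_def)
  have "u \<bullet> (\<tau> *\<^sub>v u) = bilinear U U / 4"
    using uc dim by (simp add: u(2) scalar_prod_def bilinear_def sum_distrib_left sum_divide_distrib lessThan_atLeast0 mult_ac)
  moreover have "2 * (u \<bullet> (z + (1/2) \<cdot>\<^sub>v map_vec complex_of_int \<delta>)) = linear_form g (\<lambda>i. z $ i + half \<delta> i) U"
    using uc z \<delta> by (simp add: u(2) scalar_prod_def linear_form_def half_def sum_distrib_left lessThan_atLeast0 mult_ac)
  ultimately show "1 * theta_term (\<lambda>i. z $ i + half \<delta> i) (2 \<cdot>\<^sub>v m + \<epsilon>) =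
      exp (of_real pi * \<i> * (u \<bullet> (\<tau> *\<^sub>v u) + 2 * (u \<bullet> (z + (1/2) \<cdot>\<^sub>v map_vec complex_of_int \<delta>))))"
    unfolding U_def[symmetric] theta_term_def gaussian_def mult_1 exp_add[symmetric]
    by (intro arg_cong[of _ _ exp]) (simp add: algebra_simps)
next
  fix U assume U: "U \<in> coset g \<epsilon>"
  then have Ul: "U \<in> lattice g" using coset_subset by blast
  have "2 * ((U $ i - \<epsilon> $ i) div 2) + \<epsilon> $ i = U $ i" if "i < g" for i
    using U that by (auto simp: coset_def)
  then show "2 \<cdot>\<^sub>v vec g (\<lambda>i. (U $ i - \<epsilon> $ i) div 2) + \<epsilon> = U"
    using Ul \<epsilon> by (intro eq_vecI) auto
  show "vec g (\<lambda>i. (U $ i - \<epsilon> $ i) div 2) \<in> carrier_vec (dim_vec \<epsilon>)" using \<epsilon> by auto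
qed

lemma theta_char_on_axis:
  assumes "\<epsilon> \<in> lattice g" "\<delta> \<in> lattice g" "i < g"
  shows "theta_char \<epsilon> \<delta> \<tau> (0\<^sub>v g + w \<cdot>\<^sub>v unit_vec (dim_vec (0\<^sub>v g :: complex vec)) i) =
    theta_series \<epsilon> (\<lambda>_. 1) (\<lambda>j. half \<delta> j + w * unit_coeff i j)"
proof -
  have "theta_char \<epsilon> \<delta> \<tau> (0\<^sub>v g + w \<cdot>\<^sub>v unit_vec (dim_vec (0\<^sub>v g :: complex vec)) i) =
      theta_series \<epsilon> (\<lambda>_. 1) (\<lambda>j. (0\<^sub>v g + w \<cdot>\<^sub>v unit_vec (dim_vec (0\<^sub>v g :: complex vec)) i) $ j + half \<delta> j)"
    by (rule theta_char_eq_theta_series) (use assms in auto)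
  also have "\<dots> = theta_series \<epsilon> (\<lambda>_. 1) (\<lambda>j. half \<delta> j + w * unit_coeff i j)"
    by (rule theta_series_cong) (use assms in \<open>auto simp: unit_coeff_def\<close>)
  finally show ?thesis .
qed

lemma partial_deriv_theta_char:
  assumes "\<epsilon> \<in> lattice g" "\<delta> \<in> lattice g" "i < g"
  shows "partial_deriv i (theta_char \<epsilon> \<delta> \<tau>) (0\<^sub>v g) =
    of_real pi * \<i> * theta_series \<epsilon> (linear_form g (unit_coeff i)) (half \<delta>)"
proof -
  have "((\<lambda>w. theta_series \<epsilon> (\<lambda>_. 1) (\<lambda>j. half \<delta> j + w * unit_coeff i j)) has_field_derivative
      of_real pi * \<i> * theta_series \<epsilon> (\<lambda>U. linear_form g (unit_coeff i) U * 1) (\<lambda>j. half \<delta> j + 0 * unit_coeff i j)) (at 0)"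
    by (rule theta_series_has_field_derivative[OF moderate_growth_const])
  then show ?thesis
    unfolding partial_deriv_def theta_char_on_axis[OF assms] by (simp add: DERIV_imp_deriv)
qed

lemma theta_gradient_expand:
  "theta_series \<epsilon> (linear_form g a) y = (\<Sum>i<g. a i * theta_series \<epsilon> (linear_form g (unit_coeff i)) y)"
proof -
  have "((\<lambda>U. \<Sum>i<g. a i * (linear_form g (unit_coeff i) U * theta_term y U)) has_sum
      (\<Sum>i<g. a i * theta_series \<epsilon> (linear_form g (unit_coeff i)) y)) (coset g \<epsilon>)"
    by (intro has_sum_sum has_sum_cmult_right theta_series_has_sum moderate_growth_linear_form)
  then have "((\<lambda>U. linear_form g a U * theta_term y U) has_sum
      (\<Sum>i<g. a i * theta_series \<epsilon> (linear_form g (unit_coeff i)) y)) (coset g \<epsilon>)"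
    by (rule has_sum_cong[THEN iffD1, rotated])
       (simp add: linear_form_unit_coeff linear_form_def[of g a] sum_distrib_left mult_ac)
  then show ?thesis
    by (rule has_sum_unique[OF theta_series_has_sum[OF moderate_growth_linear_form]])
qed

text \<open>The sign change on the coordinates in \<open>J\<close> leaves the quadratic form unchanged because \<open>\<tau>\<close> has no
  entries linking \<open>J\<close> to its complement. It multiplies the character by \<open>exp (- \<pi>\<i> \<Sum>\<delta>\<^sub>j U\<^sub>j)\<close>, the sum
  being over \<open>J\<close>, and this is \<open>-1\<close> since \<open>U \<equiv> \<epsilon>\<close> modulo 2 and \<open>\<Sum>\<delta>\<^sub>j \<epsilon>\<^sub>j\<close> is odd.\<close>

lemma theta_series_vanishes_if_odd_on_block:
  assumes block: "\<And>i j. i < g \<Longrightarrow> j < g \<Longrightarrow> (i \<in> J) \<noteq> (j \<in> J) \<Longrightarrow> \<tau> $$ (i, j) = 0"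
    and y: "\<And>j. j \<in> J \<Longrightarrow> y j = half \<delta> j"
    and J: "J \<subseteq> {..<g}" and odd: "odd (\<Sum>j\<in>J. \<delta> $ j * \<epsilon> $ j)"
  shows "theta_series \<epsilon> (\<lambda>_. 1) y = 0"
proof -
  define flip where "flip = (\<lambda>U :: int vec. vec g (\<lambda>j. if j \<in> J then - U $ j else U $ j))"
  have flip_coset: "flip U \<in> coset g \<epsilon>" if "U \<in> coset g \<epsilon>" for U
    using that by (auto simp: coset_def flip_def)
  have flip_flip: "flip (flip U) = U" if "U \<in> coset g \<epsilon>" for U
    using that by (auto simp: coset_def flip_def intro!: eq_vecI)
  have sign: "theta_term y (flip U) = - theta_term y U" if U: "U \<in> coset g \<epsilon>" for U
  proof -
    have bilinear: "bilinear (flip U) (flip U) = bilinear U U"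
      unfolding bilinear_def using block by (intro sum.cong refl) (auto simp: flip_def)
    have "even (\<Sum>j\<in>J. \<delta> $ j * (U $ j - \<epsilon> $ j))"
      using U J by (intro dvd_sum dvd_mult) (auto simp: coset_def)
    then have "odd (\<Sum>j\<in>J. \<delta> $ j * U $ j)"
      using odd by (simp add: algebra_simps sum_subtractf)
    then obtain m where m: "(\<Sum>j\<in>J. \<delta> $ j * U $ j) = 2 * m + 1" by (elim oddE)
    have "linear_form g y U - linear_form g y (flip U) = (\<Sum>j<g. if j \<in> J then of_int (\<delta> $ j * U $ j) else 0)"
      unfolding linear_form_def sum_subtractf[symmetric]
      by (intro sum.cong refl) (auto simp: flip_def y half_def)
    also have "\<dots> = of_int (\<Sum>j\<in>J. \<delta> $ j * U $ j)"
    proof -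
      have "{..<g} \<inter> J = J" using J by blast
      then show ?thesis by (simp add: sum.If_cases)
    qed
    finally have "linear_form g y U = linear_form g y (flip U) + of_int (2 * m + 1)"
      unfolding m by (simp add: algebra_simps)
    then have "exp (of_real pi * \<i> * linear_form g y U) =
        exp (of_real pi * \<i> * linear_form g y (flip U)) * (exp (2 * of_real pi * \<i> * of_int m) * exp (of_real pi * \<i>))"
      unfolding exp_add[symmetric] by (intro arg_cong[of _ _ exp]) (simp add: algebra_simps)
    also have "exp (2 * of_real pi * \<i> * of_int m) = (1::complex)"
      unfolding exp_two_pi_i_eq_1_iff by simp
    also have "exp (of_real pi * \<i>) = (- 1 :: complex)" by (simp add: exp_pi_i)
    finally show ?thesis by (simp add: theta_term_def gaussian_def bilinear)
  qed
  have "theta_series \<epsilon> (\<lambda>_. 1) y = infsum (\<lambda>U. - (1 * theta_term y U)) (coset g \<epsilon>)"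
    unfolding theta_series_def
    by (rule infsum_reindex_bij_witness[of _ flip flip]) (use flip_coset flip_flip sign in auto)
  also have "\<dots> = - theta_series \<epsilon> (\<lambda>_. 1) y"
    by (simp add: theta_series_def infsum_uminus)
  finally show ?thesis by simp
qed

lemma partial_deriv_zero_if_odd_on_block:
  assumes block: "\<And>i j. i < g \<Longrightarrow> j < g \<Longrightarrow> (i \<in> J) \<noteq> (j \<in> J) \<Longrightarrow> \<tau> $$ (i, j) = 0"
    and J: "J \<subseteq> {..<g}" and odd: "odd (\<Sum>j\<in>J. \<delta> $ j * \<epsilon> $ j)"
    and "\<epsilon> \<in> lattice g" "\<delta> \<in> lattice g" and i: "i < g" "i \<notin> J"
  shows "partial_deriv i (theta_char \<epsilon> \<delta> \<tau>) (0\<^sub>v g) = 0"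
proof -
  have "theta_series \<epsilon> (\<lambda>_. 1) (\<lambda>j. half \<delta> j + w * unit_coeff i j) = 0" for w
    by (rule theta_series_vanishes_if_odd_on_block[OF block _ J odd]) (use i in \<open>auto simp: unit_coeff_def\<close>)
  then show ?thesis
    unfolding partial_deriv_def theta_char_on_axis[OF assms(4,5) i(1)] by simp
qed

text \<open>The condition of the theorem, for a fixed \<open>k\<close> and with \<open>\<tau>\<close> in place of the transformed period matrix.\<close>

definition gradient_condition :: "nat \<Rightarrow> bool" where
  "gradient_condition k \<longleftrightarrow>
      (\<forall>\<epsilon> \<in> binary_vecs g. \<forall>\<delta> \<in> binary_vecs g. odd_characteristic \<epsilon> \<delta> \<longrightarrow>
        (even_characteristic (vec_first \<epsilon> k) (vec_first \<delta> k) \<longrightarrow>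
          (\<forall>i. i < k \<longrightarrow> partial_deriv i (theta_char \<epsilon> \<delta> \<tau>) (0\<^sub>v g) = 0)) \<and>
        (odd_characteristic (vec_first \<epsilon> k) (vec_first \<delta> k) \<longrightarrow>
          (\<forall>i. k \<le> i \<and> i < g \<longrightarrow> partial_deriv i (theta_char \<epsilon> \<delta> \<tau>) (0\<^sub>v g) = 0)))"

lemma characteristic_parity:
  assumes "\<delta> \<in> lattice g"
  shows "odd_characteristic \<epsilon> \<delta> \<longleftrightarrow> odd (\<Sum>j<g. \<delta> $ j * \<epsilon> $ j)"
    and "odd_characteristic (vec_first \<epsilon> k) (vec_first \<delta> k) \<longleftrightarrow> odd (\<Sum>j<k. \<delta> $ j * \<epsilon> $ j)"
    and "even_characteristic (vec_first \<epsilon> k) (vec_first \<delta> k) \<longleftrightarrow> even (\<Sum>j<k. \<delta> $ j * \<epsilon> $ j)"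
proof -
  have "\<epsilon> \<bullet> \<delta> = (\<Sum>j<g. \<delta> $ j * \<epsilon> $ j)"
    "vec_first \<epsilon> k \<bullet> vec_first \<delta> k = (\<Sum>j<k. \<delta> $ j * \<epsilon> $ j)"
    using assms by (auto simp: scalar_prod_def vec_first_def lessThan_atLeast0 mult.commute)
  then show "odd_characteristic \<epsilon> \<delta> \<longleftrightarrow> odd (\<Sum>j<g. \<delta> $ j * \<epsilon> $ j)"
    and "odd_characteristic (vec_first \<epsilon> k) (vec_first \<delta> k) \<longleftrightarrow> odd (\<Sum>j<k. \<delta> $ j * \<epsilon> $ j)"
    and "even_characteristic (vec_first \<epsilon> k) (vec_first \<delta> k) \<longleftrightarrow> even (\<Sum>j<k. \<delta> $ j * \<epsilon> $ j)"
    by (simp_all add: odd_characteristic_def even_characteristic_def even_iff_mod_2_eq_zero odd_iff_mod_2_eq_one)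
qed

lemma gradient_condition_if_block_diagonal:
  assumes block: "\<And>i j. i < g \<Longrightarrow> j < g \<Longrightarrow> (i < k) \<noteq> (j < k) \<Longrightarrow> \<tau> $$ (i, j) = 0" and k: "k < g"
  shows "gradient_condition k"
  unfolding gradient_condition_def
proof (intro ballI impI conjI allI)
  fix \<epsilon> \<delta> i
  assume \<epsilon>\<delta>: "\<epsilon> \<in> binary_vecs g" "\<delta> \<in> binary_vecs g" and o: "odd_characteristic \<epsilon> \<delta>"
  then have l: "\<epsilon> \<in> lattice g" "\<delta> \<in> lattice g" by (auto simp: binary_vecs_def)
  have odd_total: "odd (\<Sum>j<g. \<delta> $ j * \<epsilon> $ j)"
    using o l by (simp add: characteristic_parity)
  {
    assume "even_characteristic (vec_first \<epsilon> k) (vec_first \<delta> k)" and i: "i < k"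
    then have "even (\<Sum>j<k. \<delta> $ j * \<epsilon> $ j)"
      using l by (simp add: characteristic_parity)
    moreover have "(\<Sum>j<g. \<delta> $ j * \<epsilon> $ j) = (\<Sum>j<k. \<delta> $ j * \<epsilon> $ j) + (\<Sum>j\<in>{k..<g}. \<delta> $ j * \<epsilon> $ j)"
      using k by (simp add: lessThan_atLeast0 sum.atLeastLessThan_concat)
    ultimately have "odd (\<Sum>j\<in>{k..<g}. \<delta> $ j * \<epsilon> $ j)" using odd_total by simp
    then show "partial_deriv i (theta_char \<epsilon> \<delta> \<tau>) (0\<^sub>v g) = 0"
      by (rule partial_deriv_zero_if_odd_on_block[where J = "{k..<g}", rotated 2]) (use l i k block in auto)
  }
  {
    assume "odd_characteristic (vec_first \<epsilon> k) (vec_first \<delta> k)" and i: "k \<le> i \<and> i < g"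
    then have "odd (\<Sum>j\<in>{..<k}. \<delta> $ j * \<epsilon> $ j)"
      using l by (simp add: characteristic_parity)
    then show "partial_deriv i (theta_char \<epsilon> \<delta> \<tau>) (0\<^sub>v g) = 0"
      by (rule partial_deriv_zero_if_odd_on_block[where J = "{..<k}", rotated 2]) (use l i k block in auto)
  }
qed

text \<open>For every characteristic one of the two directional derivatives vanishes: both for even
  characteristics, and the one named by the condition for odd ones.\<close>

lemma off_diagonal_integral_if_gradient_condition:
  assumes cond: "gradient_condition k" and k: "k < g" and i: "i < k" and j: "k \<le> j" "j < g"
  shows "\<tau> $$ (j, i) \<in> \<int>"
proof (rule off_diagonal_integral[OF _ _ i j])
  show "k \<le> g" using k by simp
  fix a b :: "nat \<Rightarrow> complex" and \<epsilon> \<delta> :: "int vec"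
  assume a: "\<And>i. k \<le> i \<Longrightarrow> a i = 0" and b: "\<And>i. i < k \<Longrightarrow> b i = 0"
    and \<epsilon>\<delta>: "\<epsilon> \<in> binary_vecs g" "\<delta> \<in> binary_vecs g"
  then have l: "\<epsilon> \<in> lattice g" "\<delta> \<in> lattice g" by (auto simp: binary_vecs_def)
  have grad: "theta_series \<epsilon> (linear_form g (unit_coeff m)) (half \<delta>) = 0"
    if "partial_deriv m (theta_char \<epsilon> \<delta> \<tau>) (0\<^sub>v g) = 0" "m < g" for m
    using that partial_deriv_theta_char[OF l that(2)] by simp
  consider "even (\<Sum>j<g. \<delta> $ j * \<epsilon> $ j)"
    | "odd_characteristic \<epsilon> \<delta>" "even_characteristic (vec_first \<epsilon> k) (vec_first \<delta> k)"
    | "odd_characteristic \<epsilon> \<delta>" "odd_characteristic (vec_first \<epsilon> k) (vec_first \<delta> k)"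
    unfolding characteristic_parity[OF l(2)] by blast
  then show "theta_series \<epsilon> (linear_form g a) (half \<delta>) * theta_series \<epsilon> (linear_form g b) (half \<delta>) = 0"
  proof cases
    case 1
    then show ?thesis by (simp add: theta_gradient_even)
  next
    case 2
    then have "theta_series \<epsilon> (linear_form g (unit_coeff m)) (half \<delta>) = 0" if "m < k" for m
      using cond \<epsilon>\<delta> that k unfolding gradient_condition_def by (intro grad) auto
    then have "a m * theta_series \<epsilon> (linear_form g (unit_coeff m)) (half \<delta>) = 0" for m
      by (cases "m < k") (auto simp: a)
    then have "theta_series \<epsilon> (linear_form g a) (half \<delta>) = 0"
      unfolding theta_gradient_expand[of \<epsilon> a] by (intro sum.neutral) simp
    then show ?thesis by simp
  next
    case 3
    then have "theta_series \<epsilon> (linear_form g (unit_coeff m)) (half \<delta>) = 0" if "k \<le> m" "m < g" for m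
      using cond \<epsilon>\<delta> that k unfolding gradient_condition_def by (intro grad) auto
    then have "b m * theta_series \<epsilon> (linear_form g (unit_coeff m)) (half \<delta>) = 0" if "m < g" for m
      using that by (cases "m < k") (auto simp: b)
    then have "theta_series \<epsilon> (linear_form g b) (half \<delta>) = 0"
      unfolding theta_gradient_expand[of \<epsilon> b] by (intro sum.neutral) simp
    then show ?thesis by simp
  qed
qed

end

theorem proposition11:
  fixes g :: nat and \<tau> :: "complex mat"
  assumes "\<tau> \<in> siegel_upper_half_space g"
  shows "reducible_period_matrix g \<tau> \<longleftrightarrow>
    (\<exists>M \<in> siegel_modular_group g. \<exists>k. 1 \<le> k \<and> k < g \<and>
      (\<forall>\<epsilon> \<in> binary_vecs g. \<forall>\<delta> \<in> binary_vecs g. odd_characteristic \<epsilon> \<delta> \<longrightarrow>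
        (even_characteristic (vec_first \<epsilon> k) (vec_first \<delta> k) \<longrightarrow>
          (\<forall>i. i < k \<longrightarrow>
             partial_deriv i (theta_char \<epsilon> \<delta> (siegel_action g M \<tau>)) (0\<^sub>v g) = 0)) \<and>
        (odd_characteristic (vec_first \<epsilon> k) (vec_first \<delta> k) \<longrightarrow>
          (\<forall>i. k \<le> i \<and> i < g \<longrightarrow>
             partial_deriv i (theta_char \<epsilon> \<delta> (siegel_action g M \<tau>)) (0\<^sub>v g) = 0))))"
proof -
  have point: "siegel_point g (siegel_action g M \<tau>)" if "M \<in> siegel_modular_group g" for M
    using modular_action.siegel_action_in_siegel[of g M \<tau>] that assms
    by (simp add: siegel_point_def modular_action_def)
  have "reducible_period_matrix g \<tau> \<longleftrightarrow> (\<exists>M \<in> siegel_modular_group g. \<exists>k. 1 \<le> k \<and> k < g \<and>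
      siegel_point.gradient_condition g (siegel_action g M \<tau>) k)"
  proof
    assume "reducible_period_matrix g \<tau>"
    then obtain M k l \<tau>1 \<tau>2 where M: "M \<in> siegel_modular_group g"
      and kl: "1 \<le> k" "1 \<le> l" "k + l = g"
      and \<tau>12: "\<tau>1 \<in> siegel_upper_half_space k" "\<tau>2 \<in> siegel_upper_half_space l"
      and eq: "siegel_action g M \<tau> = four_block_mat \<tau>1 (0\<^sub>m k l) (0\<^sub>m l k) \<tau>2"
      unfolding reducible_period_matrix_def by blast
    interpret siegel_point g "siegel_action g M \<tau>" by (rule point[OF M])
    have "gradient_condition k"
      by (rule gradient_condition_if_block_diagonal)
         (use kl siegel_carrier[OF \<tau>12(1)] siegel_carrier[OF \<tau>12(2)] in \<open>auto simp: eq\<close>)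
    then show "\<exists>M \<in> siegel_modular_group g. \<exists>k. 1 \<le> k \<and> k < g \<and>
        siegel_point.gradient_condition g (siegel_action g M \<tau>) k"
      using M kl by (intro bexI[of _ M] exI[of _ k]) auto
  next
    assume "\<exists>M \<in> siegel_modular_group g. \<exists>k. 1 \<le> k \<and> k < g \<and>
        siegel_point.gradient_condition g (siegel_action g M \<tau>) k"
    then obtain M k where M: "M \<in> siegel_modular_group g" and k: "1 \<le> k" "k < g"
      and cond: "siegel_point.gradient_condition g (siegel_action g M \<tau>) k" by blast
    define \<tau>' where "\<tau>' = siegel_action g M \<tau>"
    interpret siegel_point g \<tau>' unfolding \<tau>'_def by (rule point[OF M])
    have \<tau>': "\<tau>' \<in> carrier_mat g g" by (rule siegel_carrier[OF siegel])
    \<comment> \<open>\<open>S\<close> is minus the off-diagonal part of \<open>\<tau>'\<close>; the floor only converts integral complex entries to integers.\<close>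
    define S where "S = mat g g (\<lambda>(i, j). if (i < k) = (j < k) then 0 else - \<lfloor>Re (\<tau>' $$ (i, j))\<rfloor>)"
    have S: "S \<in> carrier_mat g g" "transpose_mat S = S"
      using \<tau>_sym by (auto simp: S_def intro!: eq_matI)
    have lower: "\<tau>' $$ (j, i) \<in> \<int>" if "i < k" "k \<le> j" "j < g" for i j
      using off_diagonal_integral_if_gradient_condition[OF cond[folded \<tau>'_def] k(2) that] .
    have int: "\<tau>' $$ (i, j) \<in> \<int>" if "i < g" "j < g" "(i < k) \<noteq> (j < k)" for i j
    proof (cases "i < k")
      case True
      then show ?thesis using lower[of i j] that \<tau>_sym[of i j] by simp
    next
      case False
      then show ?thesis using lower[of j i] that by simp
    qed
    let ?M = "translation g S * M"
    have M': "?M \<in> siegel_modular_group g" by (rule translation_mult_in_modular_group[OF S M])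
    have act: "siegel_action g ?M \<tau> = \<tau>' + map_mat of_int S"
      unfolding \<tau>'_def by (rule siegel_action_translation[OF S(1) M assms])
    define \<tau>1 \<tau>2 where "\<tau>1 = mat k k (\<lambda>(i, j). \<tau>' $$ (i, j))"
      and "\<tau>2 = mat (g - k) (g - k) (\<lambda>(i, j). \<tau>' $$ (i + k, j + k))"
    have c: "\<tau>1 \<in> carrier_mat k k" "\<tau>2 \<in> carrier_mat (g - k) (g - k)"
      by (auto simp: \<tau>1_def \<tau>2_def)
    have block: "siegel_action g ?M \<tau> = four_block_mat \<tau>1 (0\<^sub>m k (g - k)) (0\<^sub>m (g - k) k) \<tau>2"
      unfolding act
    proof (rule eq_matI)
      fix i j assume "i < dim_row (four_block_mat \<tau>1 (0\<^sub>m k (g - k)) (0\<^sub>m (g - k) k) \<tau>2)"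
        "j < dim_col (four_block_mat \<tau>1 (0\<^sub>m k (g - k)) (0\<^sub>m (g - k) k) \<tau>2)"
      then have ij: "i < g" "j < g" using k by (auto simp: \<tau>1_def \<tau>2_def)
      have "of_int \<lfloor>Re (\<tau>' $$ (i, j))\<rfloor> = \<tau>' $$ (i, j)" if "(i < k) \<noteq> (j < k)"
        using int[OF ij that] by (auto elim!: Ints_cases)
      then show "(\<tau>' + map_mat of_int S) $$ (i, j) =
          four_block_mat \<tau>1 (0\<^sub>m k (g - k)) (0\<^sub>m (g - k) k) \<tau>2 $$ (i, j)"
        using ij \<tau>' S(1) by (auto simp: \<tau>1_def \<tau>2_def S_def)
    qed (use \<tau>' S k in \<open>auto simp: \<tau>1_def \<tau>2_def\<close>)
    have "four_block_mat \<tau>1 (0\<^sub>m k (g - k)) (0\<^sub>m (g - k) k) \<tau>2 \<in> siegel_upper_half_space (k + (g - k))"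
      using siegel_point.siegel[OF point[OF M']] k unfolding block by simp
    note siegel_block_diagonal[OF this c]
    then show "reducible_period_matrix g \<tau>"
      unfolding reducible_period_matrix_def using M' block k
      by (intro bexI[of _ ?M] exI[of _ k] exI[of _ "g - k"]) auto
  qed
  also have "\<dots> \<longleftrightarrow> (\<exists>M \<in> siegel_modular_group g. \<exists>k. 1 \<le> k \<and> k < g \<and>
      (\<forall>\<epsilon> \<in> binary_vecs g. \<forall>\<delta> \<in> binary_vecs g. odd_characteristic \<epsilon> \<delta> \<longrightarrow>
        (even_characteristic (vec_first \<epsilon> k) (vec_first \<delta> k) \<longrightarrow>
          (\<forall>i. i < k \<longrightarrow>
             partial_deriv i (theta_char \<epsilon> \<delta> (siegel_action g M \<tau>)) (0\<^sub>v g) = 0)) \<and>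
        (odd_characteristic (vec_first \<epsilon> k) (vec_first \<delta> k) \<longrightarrow>
          (\<forall>i. k \<le> i \<and> i < g \<longrightarrow>
             partial_deriv i (theta_char \<epsilon> \<delta> (siegel_action g M \<tau>)) (0\<^sub>v g) = 0))))"
    by (intro bex_cong ex_cong1 conj_cong refl siegel_point.gradient_condition_def[OF point])
  finally show ?thesis .
qed

end
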